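(* Let $F(X)$ be the free group on a finite set $X$. (1) Let $K \le F(X)$ be a finitely generated subgroup. If $K \le H$ (where $H \le F(X)$) is an algebraic extension, then $(\Gamma(H),1_H)$ is a principal quotient of $\Gamma(K)$. In particular, $H$ is finitely generated. (2) For a finitely generated subgroup $K \le F(X)$ there are only finitely many subgroups $H \le F(X)$ such that $K \le H$ is an algebraic extension. (3) Let $K \le H$ be finitely generated subgroups of $F(X)$ and suppose that the extension $K \le H$ is free. Then there exist subgroups $K', C$ such that $K \le K'$, $H = K' * C$ and $(\Gamma(K'),1_{K'})$ is a principal quotient of $\Gamma(K)$. (4) Let $K \le H$ be finitely generated subgroups of $F(X)$. Then there is a free factor $K'$ of $H$ such that $K \le K'$ and $K \le K'$ is an algebraic extension.
   Context: Extensions: let $K \le H \le F(X)$. $H$ is a free extension of $K$ if there are subgroups $C \ne 1$ and $K'$ of $F(X)$ such that $K \le K'$ and $H = K' * C$ (internal free product). If $K \le H$ is not a free extension, it is called an algebraic extension. Graphs: elements of $F(X)$ are identified with freely reduced words in $X \cup X^{-1}$. An $X$-digraph $\Gamma$ is a directed graph (possibly infinite, loops and multiple edges allowed) in which every edge $e$, with origin $o(e)$ and terminus $t(e)$, is labelled by a letter of $X$. Each edge $e$ with label $x$ is given a formal inverse $e^{-1}$ from $t(e)$ to $o(e)$ with label $x^{-1}$, and $(e^{-1})^{-1}=e$. A path is a finite sequence $e_1,\dots,e_k$ of edges or inverse edges with $o(e_{i+1})=t(e_i)$ (length-zero paths at a vertex are allowed, with empty label); its label is the word obtained by concatenating the labels;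 it is reduced if it contains no consecutive pair $e, e^{-1}$. A morphism of $X$-digraphs maps vertices to vertices and directed edges to directed edges, preserving labels, origins and termini. $\Gamma$ is folded if for each vertex $v$ and each $a\in X$ there is at most one edge with origin $v$ and label $a$ and at most one edge with terminus $v$ and label $a$. $L(\Gamma,v)$ is the set of labels of reduced paths from $v$ to $v$; if $\Gamma$ is folded it is a subgroup of $F(X)$. $Core(\Gamma,v)$ is the union of all reduced paths from $v$ to $v$; $\Gamma$ is a core graph with respect to $v$ if $Core(\Gamma,v)=\Gamma$. For every subgroup $H\le F(X)$ there is a unique (up to a unique isomorphism of based $X$-digraphs) based $X$-digraph $(\Gamma(H),1_H)$ such that $\Gamma(H)$ is folded, connected, a core graph with respect to $1_H$, and $L(\Gamma(H),1_H)=H$. It is finite if and only if $H$ is finitely generated. Principal quotients: for a finitely generated $K\le F(X)$, a principal quotient of $\Gamma(K)$ is a based $X$-digraph $(\Delta,v)$, considered up to isomorphism of based $X$-digraphs, such that $\Delta$ is finite, connected, folded and a core graph with respect to $v$, and there is a surjective (on vertices and edges) morphism $f:\Gamma(K)\to\Delta$ with $f(1_K)=v$. *)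

theory Defs
  imports "HOL-Algebra.Generated_Groups" "Graph_Theory.Digraph"
begin

section \<open>The free group as the group of freely reduced words\<close>

text \<open>
  The signed letter \<open>(x, True)\<close> stands for \<open>x\<close> and \<open>(x, False)\<close> for its formal inverse. Edges of a
  digraph are signed in the same way, so that the predicate \<open>reduced\<close> serves for words and for
  paths.
\<close>

definition flip :: "'b \<times> bool \<Rightarrow> 'b \<times> bool" where
  "flip l = (fst l, \<not> snd l)"

definition reduced :: "('b \<times> bool) list \<Rightarrow> bool" where
  "reduced w \<longleftrightarrow> successively (\<lambda>l m. m \<noteq> flip l) w"

text \<open>
  \<open>push l w\<close> is the reduced form of the word \<open>l # w\<close>, for reduced \<open>w\<close>.
\<close>

fun push :: "'b \<times> bool \<Rightarrow> ('b \<times> bool) list \<Rightarrow> ('b \<times> bool) list" where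
  "push l [] = [l]"
| "push l (m # w) = (if m = flip l then w else l # m # w)"

definition free_group :: "'a set \<Rightarrow> ('a \<times> bool) list monoid" where
  "free_group X =
     \<lparr>carrier = {w. reduced w \<and> fst ` set w \<subseteq> X}, monoid.mult = foldr push, one = []\<rparr>"

lemma flip_flip [simp]: "flip (flip l) = l"
  by (simp add: flip_def)

lemma flip_neq [simp]: "flip l \<noteq> l" "l \<noteq> flip l"
  by (auto simp: flip_def prod_eq_iff)

lemma fst_flip [simp]: "fst (flip l) = fst l"
  by (simp add: flip_def)

lemma reduced_Nil [simp]: "reduced []"
  by (simp add: reduced_def)

lemma reduced_Cons: "reduced (l # w) \<longleftrightarrow> (w = [] \<or> hd w \<noteq> flip l) \<and> reduced w"
  by (cases w) (auto simp: reduced_def)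

lemma reduced_push: "reduced w \<Longrightarrow> reduced (push l w)"
  by (cases w) (auto simp: reduced_Cons)

lemma reduced_foldr_push: "reduced w \<Longrightarrow> reduced (foldr push u w)"
  by (induction u) (auto simp: reduced_push)

lemma set_push: "set (push l w) \<subseteq> insert l (set w)"
  by (cases w) auto

lemma set_foldr_push: "set (foldr push u w) \<subseteq> set u \<union> set w"
proof (induction u)
  case (Cons l u)
  then show ?case using set_push[of l "foldr push u w"] by auto
qed simp

lemma push_push_flip: "reduced w \<Longrightarrow> push l (push (flip l) w) = w"
proof (cases w)
  case (Cons m v)
  assume "reduced w"
  then show ?thesis using Cons by (cases v) (auto simp: reduced_Cons)
qed simp

lemma foldr_push_push:
  assumes "reduced w" shows "foldr push (push l v) w = push l (foldr push v w)"
proof (cases v)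
  case (Cons m v')
  then show ?thesis
    using push_push_flip[OF reduced_foldr_push[OF assms], of l v'] by auto
qed simp

lemma foldr_push_assoc:
  "reduced w \<Longrightarrow> foldr push (foldr push u v) w = foldr push u (foldr push v w)"
  by (induction u) (auto simp: foldr_push_push)

lemma foldr_push_Nil: "reduced w \<Longrightarrow> foldr push w [] = w"
proof (induction w)
  case (Cons l w)
  then show ?case by (cases w) (auto simp: reduced_Cons)
qed simp

lemma foldr_push_inverse: "reduced w \<Longrightarrow> foldr push (rev (map flip u)) (foldr push u w) = w"
proof (induction u)
  case (Cons l u)
  then show ?case using push_push_flip[OF reduced_foldr_push[of w u], of "flip l"] by simp
qed simp

lemma reduced_rev_map_flip: "reduced w \<Longrightarrow> reduced (rev (map flip w))"
proof -
  have "l \<noteq> flip m" if "m \<noteq> flip l" for l m :: "'a \<times> bool"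
    using that flip_flip[of m] by auto
  moreover have "flip l \<noteq> flip (flip m)" if "m \<noteq> flip l" for l m :: "'a \<times> bool"
    using that by simp
  moreover assume "reduced w"
  ultimately show ?thesis
    unfolding reduced_def successively_rev successively_map
    by (elim successively_mono) simp
qed

lemma free_group_simps:
  "carrier (free_group X) = {w. reduced w \<and> fst ` set w \<subseteq> X}"
  "u \<otimes>\<^bsub>free_group X\<^esub> w = foldr push u w"
  "\<one>\<^bsub>free_group X\<^esub> = []"
  by (simp_all add: free_group_def)

lemma group_free_group: "group (free_group X)"
proof (rule groupI)
  fix u w assume "u \<in> carrier (free_group X)" "w \<in> carrier (free_group X)"
  then show "u \<otimes>\<^bsub>free_group X\<^esub> w \<in> carrier (free_group X)"
    using set_foldr_push[of u w] by (force simp: free_group_simps reduced_foldr_push)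
next
  fix w assume "w \<in> carrier (free_group X)"
  then show "\<exists>u \<in> carrier (free_group X). u \<otimes>\<^bsub>free_group X\<^esub> w = \<one>\<^bsub>free_group X\<^esub>"
    using foldr_push_inverse[of "[]" w] reduced_rev_map_flip[of w]
    by (intro bexI[of _ "rev (map flip w)"])
       (auto simp: free_group_simps foldr_push_Nil image_image)
qed (auto simp: free_group_simps foldr_push_assoc)

section \<open>Free and algebraic extensions\<close>

definition finitely_generated :: "('g, 'm) monoid_scheme \<Rightarrow> 'g set \<Rightarrow> bool" where
  "finitely_generated G H \<longleftrightarrow> (\<exists>S. finite S \<and> S \<subseteq> carrier G \<and> H = generate G S)"

text \<open>
  The underlying set of the (external) free product of the subgroups \<open>A\<close> and \<open>B\<close>: the alternating
  sequences of nontrivial elements of the disjoint copies of \<open>A\<close> and \<open>B\<close>.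
\<close>

definition alternating :: "('g, 'm) monoid_scheme \<Rightarrow> 'g set \<Rightarrow> 'g set \<Rightarrow> ('g + 'g) list set" where
  "alternating G A B =
     {s. set s \<subseteq> (A - {\<one>\<^bsub>G\<^esub>}) <+> (B - {\<one>\<^bsub>G\<^esub>}) \<and> successively (\<lambda>a b. isl a \<noteq> isl b) s}"

definition evaluate :: "('g, 'm) monoid_scheme \<Rightarrow> ('g + 'g) list \<Rightarrow> 'g" where
  "evaluate G s = foldr (\<lambda>a h. case_sum id id a \<otimes>\<^bsub>G\<^esub> h) s \<one>\<^bsub>G\<^esub>"

text \<open>
  \<open>H\<close> is the internal free product of its subgroups \<open>A\<close> and \<open>B\<close> if the canonical map from the free
  product of \<open>A\<close> and \<open>B\<close> is a bijection onto \<open>H\<close>. Trivial factors are allowed.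
\<close>

definition internal_free_product ::
    "('g, 'm) monoid_scheme \<Rightarrow> 'g set \<Rightarrow> 'g set \<Rightarrow> 'g set \<Rightarrow> bool" where
  "internal_free_product G H A B \<longleftrightarrow>
     subgroup H G \<and> subgroup A G \<and> subgroup B G \<and>
     bij_betw (evaluate G) (alternating G A B) H"

definition free_factor :: "('g, 'm) monoid_scheme \<Rightarrow> 'g set \<Rightarrow> 'g set \<Rightarrow> bool" where
  "free_factor G A H \<longleftrightarrow> (\<exists>B. internal_free_product G H A B)"

definition extension :: "('g, 'm) monoid_scheme \<Rightarrow> 'g set \<Rightarrow> 'g set \<Rightarrow> bool" where
  "extension G K H \<longleftrightarrow> subgroup K G \<and> subgroup H G \<and> K \<subseteq> H"

definition free_extension :: "('g, 'm) monoid_scheme \<Rightarrow> 'g set \<Rightarrow> 'g set \<Rightarrow> bool" where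
  "free_extension G K H \<longleftrightarrow>
     extension G K H \<and>
     (\<exists>C K'. C \<noteq> {\<one>\<^bsub>G\<^esub>} \<and> K \<subseteq> K' \<and> internal_free_product G H K' C)"

definition algebraic_extension :: "('g, 'm) monoid_scheme \<Rightarrow> 'g set \<Rightarrow> 'g set \<Rightarrow> bool" where
  "algebraic_extension G K H \<longleftrightarrow> extension G K H \<and> \<not> free_extension G K H"

section \<open>Labelled digraphs\<close>

record ('v, 'e, 'a) labelled_digraph = "('v, 'e) pre_digraph" +
  lab :: "'e \<Rightarrow> 'a"

definition X_digraph :: "'a set \<Rightarrow> ('v, 'e, 'a) labelled_digraph \<Rightarrow> bool" where
  "X_digraph X \<Gamma> \<longleftrightarrow> wf_digraph (pre_digraph.truncate \<Gamma>) \<and> lab \<Gamma> ` arcs \<Gamma> \<subseteq> X"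

definition finite_digraph :: "('v, 'e, 'a) labelled_digraph \<Rightarrow> bool" where
  "finite_digraph \<Gamma> \<longleftrightarrow> finite (verts \<Gamma>) \<and> finite (arcs \<Gamma>)"

text \<open>Signed edges: \<open>(e, True)\<close> is the edge \<open>e\<close> and \<open>(e, False)\<close> is its formal inverse.\<close>

definition origin :: "('v, 'e, 'a) labelled_digraph \<Rightarrow> 'e \<times> bool \<Rightarrow> 'v" where
  "origin \<Gamma> d = (if snd d then tail \<Gamma> (fst d) else head \<Gamma> (fst d))"

definition terminus :: "('v, 'e, 'a) labelled_digraph \<Rightarrow> 'e \<times> bool \<Rightarrow> 'v" where
  "terminus \<Gamma> d = (if snd d then head \<Gamma> (fst d) else tail \<Gamma> (fst d))"

fun is_path :: "('v, 'e, 'a) labelled_digraph \<Rightarrow> 'v \<Rightarrow> ('e \<times> bool) list \<Rightarrow> 'v \<Rightarrow> bool" where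
  "is_path \<Gamma> u [] v \<longleftrightarrow> u \<in> verts \<Gamma> \<and> u = v"
| "is_path \<Gamma> u (d # p) v \<longleftrightarrow> fst d \<in> arcs \<Gamma> \<and> origin \<Gamma> d = u \<and> is_path \<Gamma> (terminus \<Gamma> d) p v"

definition path_label :: "('v, 'e, 'a) labelled_digraph \<Rightarrow> ('e \<times> bool) list \<Rightarrow> ('a \<times> bool) list" where
  "path_label \<Gamma> p = map (\<lambda>d. (lab \<Gamma> (fst d), snd d)) p"

definition reduced_loops ::
    "('v, 'e, 'a) labelled_digraph \<Rightarrow> 'v \<Rightarrow> ('e \<times> bool) list set" where
  "reduced_loops \<Gamma> v = {p. is_path \<Gamma> v p v \<and> reduced p}"

definition loop_labels :: "('v, 'e, 'a) labelled_digraph \<Rightarrow> 'v \<Rightarrow> ('a \<times> bool) list set" where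
  "loop_labels \<Gamma> v = path_label \<Gamma> ` reduced_loops \<Gamma> v"

definition folded :: "('v, 'e, 'a) labelled_digraph \<Rightarrow> bool" where
  "folded \<Gamma> \<longleftrightarrow>
     (\<forall>e \<in> arcs \<Gamma>. \<forall>e' \<in> arcs \<Gamma>. lab \<Gamma> e = lab \<Gamma> e' \<longrightarrow>
        (tail \<Gamma> e = tail \<Gamma> e' \<longrightarrow> e = e') \<and> (head \<Gamma> e = head \<Gamma> e' \<longrightarrow> e = e'))"

definition connected_digraph :: "('v, 'e, 'a) labelled_digraph \<Rightarrow> bool" where
  "connected_digraph \<Gamma> \<longleftrightarrow>
     verts \<Gamma> \<noteq> {} \<and> (\<forall>u \<in> verts \<Gamma>. \<forall>v \<in> verts \<Gamma>. \<exists>p. is_path \<Gamma> u p v)"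

definition Core ::
    "('v, 'e, 'a) labelled_digraph \<Rightarrow> 'v \<Rightarrow> ('v, 'e, 'a) labelled_digraph" where
  "Core \<Gamma> v = \<Gamma>\<lparr>
     verts := (\<Union>p \<in> reduced_loops \<Gamma> v. insert v (origin \<Gamma> ` set p \<union> terminus \<Gamma> ` set p)),
     arcs := (\<Union>p \<in> reduced_loops \<Gamma> v. fst ` set p)\<rparr>"

definition core_graph :: "('v, 'e, 'a) labelled_digraph \<Rightarrow> 'v \<Rightarrow> bool" where
  "core_graph \<Gamma> v \<longleftrightarrow> v \<in> verts \<Gamma> \<and> Core \<Gamma> v = \<Gamma>"

definition digraph_morphism ::
    "('v, 'e, 'a) labelled_digraph \<Rightarrow> ('w, 'f, 'a) labelled_digraph \<Rightarrow>
      ('v \<Rightarrow> 'w) \<Rightarrow> ('e \<Rightarrow> 'f) \<Rightarrow> bool" where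
  "digraph_morphism \<Gamma> \<Delta> f g \<longleftrightarrow>
     (\<forall>v \<in> verts \<Gamma>. f v \<in> verts \<Delta>) \<and>
     (\<forall>e \<in> arcs \<Gamma>. g e \<in> arcs \<Delta> \<and> lab \<Delta> (g e) = lab \<Gamma> e \<and>
        tail \<Delta> (g e) = f (tail \<Gamma> e) \<and> head \<Delta> (g e) = f (head \<Gamma> e))"

section \<open>The based digraph of a subgroup\<close>

definition represents ::
    "'a set \<Rightarrow> ('v, 'e, 'a) labelled_digraph \<times> 'v \<Rightarrow> ('a \<times> bool) list set \<Rightarrow> bool" where
  "represents X = (\<lambda>(\<Gamma>, v) H.
     X_digraph X \<Gamma> \<and> folded \<Gamma> \<and> connected_digraph \<Gamma> \<and> core_graph \<Gamma> v \<and> loop_labels \<Gamma> v = H)"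

text \<open>
  The based digraph representing \<open>H\<close> is determined only up to isomorphism; \<open>subgroup_graph\<close> chooses
  one whose vertices are sets of words and whose edges are pairs of such a set and a letter. These
  types are large enough: the core of the Schreier graph of the cosets of \<open>H\<close> is a possible choice,
  see \<open>represents_subgroup_graph\<close>.
\<close>

type_synonym 'a subgroup_digraph =
  "(('a \<times> bool) list set, ('a \<times> bool) list set \<times> 'a, 'a) labelled_digraph"

definition subgroup_graph ::
    "'a set \<Rightarrow> ('a \<times> bool) list set \<Rightarrow> 'a subgroup_digraph \<times> ('a \<times> bool) list set" where
  "subgroup_graph X H = (SOME \<Gamma>v. represents X \<Gamma>v H)"

lemma is_path_append:
  "is_path \<Gamma> u (p @ q) w \<longleftrightarrow> (\<exists>v. is_path \<Gamma> u p v \<and> is_path \<Gamma> v q w)"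
  if "X_digraph X \<Gamma>"
proof (induction p arbitrary: u)
  case Nil
  have "u \<in> verts \<Gamma>" if "is_path \<Gamma> u q w"
    using that \<open>X_digraph X \<Gamma>\<close>
    by (cases q) (auto simp: X_digraph_def wf_digraph_def pre_digraph.truncate_def origin_def)
  then show ?case by auto
next
  case (Cons d p)
  then show ?case by auto
qed

lemma is_path_split:
  assumes "X_digraph X \<Gamma>" "is_path \<Gamma> u p w" "x \<in> origin \<Gamma> ` set p \<union> terminus \<Gamma> ` set p"
  shows "\<exists>q r. p = q @ r \<and> is_path \<Gamma> u q x \<and> is_path \<Gamma> x r w"
proof -
  from assms(3) obtain d where d: "d \<in> set p" "x = origin \<Gamma> d \<or> x = terminus \<Gamma> d" by auto
  from d(1) obtain q r where p: "p = q @ d # r" by (auto dest: split_list)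
  with assms have q: "is_path \<Gamma> u q (origin \<Gamma> d)" and r: "is_path \<Gamma> (terminus \<Gamma> d) r w"
    and a: "fst d \<in> arcs \<Gamma>"
    by (auto simp: is_path_append[OF assms(1)])
  have t: "terminus \<Gamma> d \<in> verts \<Gamma>"
    using a assms(1)
    by (auto simp: X_digraph_def wf_digraph_def pre_digraph.truncate_def terminus_def)
  show ?thesis
  proof (cases "x = origin \<Gamma> d")
    case True
    then show ?thesis using q r a p by (intro exI[of _ q] exI[of _ "d # r"]) auto
  next
    case False
    with d have "x = terminus \<Gamma> d" by simp
    then show ?thesis using q r a p t
      by (intro exI[of _ "q @ [d]"] exI[of _ r]) (auto simp: is_path_append[OF assms(1)])
  qed
qed

lemma reduced_path_label:
  assumes "folded \<Gamma>" "is_path \<Gamma> u p w" "reduced p"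
  shows "reduced (path_label \<Gamma> p)"
  using assms(2,3)
proof (induction p arbitrary: u)
  case Nil
  then show ?case by (simp add: path_label_def)
next
  case (Cons d p)
  show ?case
  proof (cases p)
    case Nil
    then show ?thesis by (simp add: path_label_def reduced_Cons)
  next
    case (Cons d' p')
    have d: "fst d \<in> arcs \<Gamma>" "fst d' \<in> arcs \<Gamma>" "origin \<Gamma> d' = terminus \<Gamma> d" "d' \<noteq> flip d"
      using Cons.prems Cons by (auto simp: reduced_Cons)
    have "(lab \<Gamma> (fst d'), snd d') \<noteq> flip (lab \<Gamma> (fst d), snd d)"
    proof
      assume *: "(lab \<Gamma> (fst d'), snd d') = flip (lab \<Gamma> (fst d), snd d)"
      then have "lab \<Gamma> (fst d') = lab \<Gamma> (fst d)" "snd d' = (\<not> snd d)" by (auto simp: flip_def)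
      with d(1-3) assms(1) have "fst d' = fst d"
        unfolding folded_def origin_def terminus_def by (auto split: if_splits)
      with \<open>snd d' = (\<not> snd d)\<close> d(4) show False by (auto simp: flip_def prod_eq_iff)
    qed
    moreover have "reduced (path_label \<Gamma> p)"
      using Cons.IH Cons.prems by (auto simp: reduced_Cons)
    ultimately show ?thesis using Cons by (auto simp: path_label_def reduced_Cons)
  qed
qed

lemma reduced_if_reduced_path_label: "reduced (path_label \<Gamma> p) \<Longrightarrow> reduced p"
  unfolding reduced_def path_label_def successively_map
  by (erule successively_mono) (auto simp: flip_def)

context
  fixes X :: "'a set" and \<Gamma> :: "('v, 'e, 'a) labelled_digraph" and v :: 'v
  assumes \<Gamma>: "X_digraph X \<Gamma>" and v: "v \<in> verts \<Gamma>"
begin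

lemma Core_simps:
  "tail (Core \<Gamma> v) = tail \<Gamma>" "head (Core \<Gamma> v) = head \<Gamma>" "lab (Core \<Gamma> v) = lab \<Gamma>"
  "origin (Core \<Gamma> v) = origin \<Gamma>" "terminus (Core \<Gamma> v) = terminus \<Gamma>"
  "path_label (Core \<Gamma> v) = path_label \<Gamma>"
  by (auto simp: Core_def origin_def terminus_def path_label_def fun_eq_iff)

lemma in_verts_Core:
  "x \<in> verts (Core \<Gamma> v) \<longleftrightarrow> (\<exists>p \<in> reduced_loops \<Gamma> v.
     x = v \<or> x \<in> origin \<Gamma> ` set p \<union> terminus \<Gamma> ` set p)"
  by (simp add: Core_def del: UN_simps)

lemma arcs_Core: "arcs (Core \<Gamma> v) \<subseteq> arcs \<Gamma>"
proof -
  have "fst ` set p \<subseteq> arcs \<Gamma>" if "is_path \<Gamma> u p w" for u p w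
    using that by (induction p arbitrary: u) auto
  then have "fst ` set p \<subseteq> arcs \<Gamma>" if "p \<in> reduced_loops \<Gamma> v" for p
    using that unfolding reduced_loops_def by blast
  then have "(\<Union>p \<in> reduced_loops \<Gamma> v. fst ` set p) \<subseteq> arcs \<Gamma>" by (rule UN_least)
  then show ?thesis unfolding Core_def by simp
qed

lemma base_in_Core: "v \<in> verts (Core \<Gamma> v)"
proof -
  have "[] \<in> reduced_loops \<Gamma> v" using v by (simp add: reduced_loops_def)
  then show ?thesis by (auto simp: Core_def)
qed

lemma verts_Core: "verts (Core \<Gamma> v) \<subseteq> verts \<Gamma>"
proof
  fix x assume "x \<in> verts (Core \<Gamma> v)"
  then obtain p where p: "p \<in> reduced_loops \<Gamma> v"
    "x = v \<or> x \<in> origin \<Gamma> ` set p \<union> terminus \<Gamma> ` set p"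
    unfolding in_verts_Core by blast
  have *: "x \<in> verts \<Gamma>" if "is_path \<Gamma> u q x" for u q
    using that by (induction q arbitrary: u) auto
  from p(1) have "is_path \<Gamma> v p v" by (simp add: reduced_loops_def)
  from p(2) show "x \<in> verts \<Gamma>"
  proof
    assume "x = v"
    then show ?thesis using v by simp
  next
    assume "x \<in> origin \<Gamma> ` set p \<union> terminus \<Gamma> ` set p"
    from is_path_split[OF \<Gamma> \<open>is_path \<Gamma> v p v\<close> this] * show ?thesis by blast
  qed
qed

lemma wf_Core: "e \<in> arcs (Core \<Gamma> v) \<Longrightarrow> tail \<Gamma> e \<in> verts (Core \<Gamma> v) \<and> head \<Gamma> e \<in> verts (Core \<Gamma> v)"
proof -
  assume "e \<in> arcs (Core \<Gamma> v)"
  then obtain p d where pd: "p \<in> reduced_loops \<Gamma> v" "d \<in> set p" "e = fst d"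
    by (auto simp: Core_def)
  then have "origin \<Gamma> d \<in> verts (Core \<Gamma> v)" "terminus \<Gamma> d \<in> verts (Core \<Gamma> v)"
    unfolding in_verts_Core by blast+
  then show ?thesis using pd(3) by (auto simp: origin_def terminus_def split: if_splits)
qed

lemma X_digraph_Core: "X_digraph X (Core \<Gamma> v)"
  using \<Gamma> subsetD[OF arcs_Core] wf_Core
  by (auto simp: X_digraph_def wf_digraph_def pre_digraph.truncate_def Core_simps)

lemma folded_Core: "folded \<Gamma> \<Longrightarrow> folded (Core \<Gamma> v)"
  using arcs_Core unfolding folded_def Core_simps by blast

lemma is_path_Core:
  assumes "is_path \<Gamma> u p w" "fst ` set p \<subseteq> arcs (Core \<Gamma> v)" "w \<in> verts (Core \<Gamma> v)"
  shows "is_path (Core \<Gamma> v) u p w"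
  using assms by (induction p arbitrary: u) (auto simp: Core_simps)

lemma is_path_Core_D: "is_path (Core \<Gamma> v) u p w \<Longrightarrow> is_path \<Gamma> u p w"
  using arcs_Core verts_Core by (induction p arbitrary: u) (auto simp: Core_simps)

lemma reduced_loops_Core: "reduced_loops (Core \<Gamma> v) v = reduced_loops \<Gamma> v"
proof -
  have "is_path (Core \<Gamma> v) v p v" if "p \<in> reduced_loops \<Gamma> v" for p
  proof (rule is_path_Core)
    show "fst ` set p \<subseteq> arcs (Core \<Gamma> v)" using that by (auto simp: Core_def)
  qed (use that base_in_Core in \<open>auto simp: reduced_loops_def\<close>)
  then show ?thesis using is_path_Core_D by (auto simp: reduced_loops_def)
qed

lemma core_graph_Core: "core_graph (Core \<Gamma> v) v"
  unfolding core_graph_def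
proof
  show "Core (Core \<Gamma> v) v = Core \<Gamma> v"
    unfolding Core_def[of "Core \<Gamma> v"] reduced_loops_Core Core_simps
    by (simp add: Core_def)
qed (rule base_in_Core)

lemma connected_Core: "connected_digraph (Core \<Gamma> v)"
proof -
  let ?C = "Core \<Gamma> v"
  have *: "\<exists>q r. is_path ?C v q x \<and> is_path ?C x r v" if x: "x \<in> verts ?C" for x
  proof (cases "x = v")
    case True
    with base_in_Core have "is_path ?C v [] x" "is_path ?C x [] v" by auto
    then show ?thesis by blast
  next
    case False
    with x obtain p where p: "p \<in> reduced_loops \<Gamma> v"
      "x \<in> origin ?C ` set p \<union> terminus ?C ` set p"
      unfolding in_verts_Core Core_simps by blast
    then have "is_path ?C v p v" using reduced_loops_Core by (auto simp: reduced_loops_def)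
    then show ?thesis using is_path_split[OF X_digraph_Core _ p(2)] by blast
  qed
  have "\<exists>p. is_path ?C x p y" if "x \<in> verts ?C" "y \<in> verts ?C" for x y
    using *[OF that(1)] *[OF that(2)] is_path_append[OF X_digraph_Core] by blast
  then show ?thesis using base_in_Core by (auto simp: connected_digraph_def)
qed

lemma represents_Core: "folded \<Gamma> \<Longrightarrow> represents X (Core \<Gamma> v, v) (loop_labels \<Gamma> v)"
  by (simp add: represents_def X_digraph_Core folded_Core connected_Core core_graph_Core
        loop_labels_def reduced_loops_Core Core_simps)

end

definition schreier_graph :: "'a set \<Rightarrow> ('a \<times> bool) list set \<Rightarrow> 'a subgroup_digraph" where
  "schreier_graph X H =
     \<lparr>verts = rcosets\<^bsub>free_group X\<^esub> H, arcs = (rcosets\<^bsub>free_group X\<^esub> H) \<times> X, tail = fst,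
      head = (\<lambda>(C, x). C #>\<^bsub>free_group X\<^esub> [(x, True)]), lab = snd\<rparr>"

context
  fixes X :: "'a set" and H :: "('a \<times> bool) list set"
  assumes H: "subgroup H (free_group X)"
begin

interpretation F: group "free_group X" by (rule group_free_group)

lemma letter_in_carrier: "x \<in> X \<Longrightarrow> [(x, b)] \<in> carrier (free_group X)"
  by (auto simp: free_group_simps reduced_Cons)

lemma rcosets_subset: "C \<in> rcosets\<^bsub>free_group X\<^esub> H \<Longrightarrow> C \<subseteq> carrier (free_group X)"
  using F.rcosets_part_G[OF H] by blast

lemma rcosets_step:
  assumes "C \<in> rcosets\<^bsub>free_group X\<^esub> H" "w \<in> carrier (free_group X)"
  shows "C #>\<^bsub>free_group X\<^esub> w \<in> rcosets\<^bsub>free_group X\<^esub> H"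
  using assms F.coset_mult_assoc[OF subgroup.subset[OF H]] F.m_closed
  by (fastforce simp: RCOSETS_def)

lemma rcosets_step_flip:
  assumes "C \<in> rcosets\<^bsub>free_group X\<^esub> H" "x \<in> X"
  shows "(C #>\<^bsub>free_group X\<^esub> [(x, b)]) #>\<^bsub>free_group X\<^esub> [(x, \<not> b)] = C"
proof -
  have "[(x, b)] \<otimes>\<^bsub>free_group X\<^esub> [(x, \<not> b)] = \<one>\<^bsub>free_group X\<^esub>"
    by (simp add: free_group_simps flip_def)
  then show ?thesis
    using F.coset_mult_assoc[OF rcosets_subset[OF assms(1)] letter_in_carrier letter_in_carrier]
      F.coset_mult_one[OF rcosets_subset[OF assms(1)]] assms(2) by metis
qed

lemma X_digraph_schreier: "X_digraph X (schreier_graph X H)"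
  by (auto simp: X_digraph_def schreier_graph_def wf_digraph_def pre_digraph.truncate_def
      intro: rcosets_step letter_in_carrier)

lemma folded_schreier: "folded (schreier_graph X H)"
proof -
  have "C = D" if "C \<in> rcosets\<^bsub>free_group X\<^esub> H" "D \<in> rcosets\<^bsub>free_group X\<^esub> H" "x \<in> X"
    "C #>\<^bsub>free_group X\<^esub> [(x, True)] = D #>\<^bsub>free_group X\<^esub> [(x, True)]" for C D x
    using rcosets_step_flip[OF that(1,3), of True] rcosets_step_flip[OF that(2,3), of True] that(4)
    by simp
  then show ?thesis by (auto simp: folded_def schreier_graph_def)
qed

lemma H_in_rcosets: "H \<in> rcosets\<^bsub>free_group X\<^esub> H"
  using F.coset_mult_one[OF subgroup.subset[OF H]] F.one_closed by (force simp: RCOSETS_def)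

lemma signed_edge_schreier:
  assumes "fst d \<in> arcs (schreier_graph X H)"
  shows "origin (schreier_graph X H) d \<in> rcosets\<^bsub>free_group X\<^esub> H"
    and "lab (schreier_graph X H) (fst d) \<in> X"
    and "terminus (schreier_graph X H) d =
      origin (schreier_graph X H) d #>\<^bsub>free_group X\<^esub> [(lab (schreier_graph X H) (fst d), snd d)]"
proof -
  obtain C x b where d: "d = ((C, x), b)" by (metis surj_pair)
  with assms have C: "C \<in> rcosets\<^bsub>free_group X\<^esub> H" "x \<in> X" by (auto simp: schreier_graph_def)
  show "origin (schreier_graph X H) d \<in> rcosets\<^bsub>free_group X\<^esub> H"
    "lab (schreier_graph X H) (fst d) \<in> X"
    using C d by (auto simp: schreier_graph_def origin_def intro: rcosets_step letter_in_carrier)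
  show "terminus (schreier_graph X H) d =
      origin (schreier_graph X H) d #>\<^bsub>free_group X\<^esub> [(lab (schreier_graph X H) (fst d), snd d)]"
    using C d rcosets_step_flip[of C x True]
    by (cases b) (auto simp: schreier_graph_def origin_def terminus_def)
qed

lemma word_in_carrier: "fst ` set w \<subseteq> X \<Longrightarrow> foldr push w [] \<in> carrier (free_group X)"
  using set_foldr_push[of w "[]"] reduced_foldr_push[of "[]" w]
  by (fastforce simp: free_group_simps)

lemma coset_mult_Cons:
  assumes "C \<in> rcosets\<^bsub>free_group X\<^esub> H" "fst l \<in> X" "fst ` set w \<subseteq> X"
  shows "C #>\<^bsub>free_group X\<^esub> [l] #>\<^bsub>free_group X\<^esub> foldr push w []
    = C #>\<^bsub>free_group X\<^esub> foldr push (l # w) []"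
  using F.coset_mult_assoc[OF rcosets_subset[OF assms(1)] letter_in_carrier[of "fst l" "snd l"]
      word_in_carrier[OF assms(3)]] assms(2)
  by (simp add: free_group_simps)

lemma is_path_schreier_D:
  assumes "is_path (schreier_graph X H) C p D"
  shows "fst ` set (path_label (schreier_graph X H) p) \<subseteq> X \<and> C \<in> rcosets\<^bsub>free_group X\<^esub> H \<and>
    D = C #>\<^bsub>free_group X\<^esub> foldr push (path_label (schreier_graph X H) p) []"
  using assms
proof (induction p arbitrary: C)
  case Nil
  then have "C \<in> rcosets\<^bsub>free_group X\<^esub> H" "C = D" by (auto simp: schreier_graph_def)
  then show ?case
    using F.coset_mult_one[OF rcosets_subset] by (simp add: path_label_def free_group_simps)
next
  case (Cons d p)
  then have d: "fst d \<in> arcs (schreier_graph X H)" "origin (schreier_graph X H) d = C" by auto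
  note e = signed_edge_schreier[OF d(1), unfolded d(2)]
  have "is_path (schreier_graph X H) (terminus (schreier_graph X H) d) p D"
    using Cons.prems by simp
  note IH = Cons.IH[OF this, THEN conjunct1] Cons.IH[OF this, THEN conjunct2, THEN conjunct2]
  show ?case
    using e IH coset_mult_Cons[OF e(1) _ IH(1), of "(lab (schreier_graph X H) (fst d), snd d)"]
    by (simp add: path_label_def)
qed

lemma is_path_schreier_I:
  assumes "C \<in> rcosets\<^bsub>free_group X\<^esub> H" "fst ` set w \<subseteq> X"
  shows "\<exists>p. is_path (schreier_graph X H) C p (C #>\<^bsub>free_group X\<^esub> foldr push w []) \<and>
    path_label (schreier_graph X H) p = w"
  using assms
proof (induction w arbitrary: C)
  case Nil
  then show ?case using F.coset_mult_one[OF rcosets_subset]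
    by (intro exI[of _ "[]"]) (simp add: path_label_def free_group_simps schreier_graph_def)
next
  case (Cons l w)
  define C' where "C' = C #>\<^bsub>free_group X\<^esub> [l]"
  obtain x b where l: "l = (x, b)" by (metis surj_pair)
  have x: "x \<in> X" using Cons.prems l by simp
  have C': "C' \<in> rcosets\<^bsub>free_group X\<^esub> H"
    unfolding C'_def l using Cons.prems x by (intro rcosets_step letter_in_carrier)
  obtain p where p: "is_path (schreier_graph X H) C' p (C' #>\<^bsub>free_group X\<^esub> foldr push w [])"
    "path_label (schreier_graph X H) p = w"
    using Cons.IH[OF C'] Cons.prems by auto
  define d where "d = ((if b then C else C', x), b)"
  have d: "fst d \<in> arcs (schreier_graph X H)" "origin (schreier_graph X H) d = C"
    "terminus (schreier_graph X H) d = C'" "(lab (schreier_graph X H) (fst d), snd d) = l"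
    using Cons.prems C' x rcosets_step_flip[of C x False]
    by (auto simp: d_def l C'_def schreier_graph_def origin_def terminus_def)
  have "C' #>\<^bsub>free_group X\<^esub> foldr push w [] = C #>\<^bsub>free_group X\<^esub> foldr push (l # w) []"
    unfolding C'_def using Cons.prems by (intro coset_mult_Cons) auto
  with p d have "is_path (schreier_graph X H) C (d # p)
      (C #>\<^bsub>free_group X\<^esub> foldr push (l # w) [])"
    by simp
  moreover have "path_label (schreier_graph X H) (d # p) = l # w"
    using p d by (simp add: path_label_def)
  ultimately show ?case by blast
qed

lemma loop_labels_schreier: "loop_labels (schreier_graph X H) H = H"
proof
  show "loop_labels (schreier_graph X H) H \<subseteq> H"
  proof
    fix w assume "w \<in> loop_labels (schreier_graph X H) H"
    then obtain p where p: "is_path (schreier_graph X H) H p H" "reduced p"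
      "w = path_label (schreier_graph X H) p"
      by (auto simp: loop_labels_def reduced_loops_def)
    then have "reduced w" using reduced_path_label[OF folded_schreier] by blast
    with is_path_schreier_D[OF p(1)] p(3)
    have w: "w \<in> carrier (free_group X)" "H = H #>\<^bsub>free_group X\<^esub> w"
      by (auto simp: free_group_simps foldr_push_Nil)
    then show "w \<in> H" using F.coset_join1[OF _ w(1) H] by simp
  qed
  show "H \<subseteq> loop_labels (schreier_graph X H) H"
  proof
    fix w assume w: "w \<in> H"
    then have "w \<in> carrier (free_group X)" using subgroup.subset[OF H] by blast
    then have c: "fst ` set w \<subseteq> X" "reduced w" "H #>\<^bsub>free_group X\<^esub> w = H"
      using F.coset_join2[OF _ H w] by (auto simp: free_group_simps)
    obtain p where "is_path (schreier_graph X H) H p H" "path_label (schreier_graph X H) p = w"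
      using is_path_schreier_I[OF H_in_rcosets c(1)] c by (auto simp: foldr_push_Nil)
    with c(2) show "w \<in> loop_labels (schreier_graph X H) H"
      using reduced_if_reduced_path_label by (force simp: loop_labels_def reduced_loops_def)
  qed
qed

lemma represents_subgroup_graph: "represents X (subgroup_graph X H) H"
proof -
  have "represents X (Core (schreier_graph X H) H, H) H"
    using represents_Core[OF X_digraph_schreier _ folded_schreier, of H] H_in_rcosets
    by (simp add: loop_labels_schreier) (simp add: schreier_graph_def)
  then show ?thesis unfolding subgroup_graph_def by (rule someI)
qed

end

definition principal_quotient ::
    "'a set \<Rightarrow> ('a \<times> bool) list set \<Rightarrow> ('v, 'e, 'a) labelled_digraph \<times> 'v \<Rightarrow> bool" where
  "principal_quotient X K = (\<lambda>(\<Delta>, v).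
     X_digraph X \<Delta> \<and> finite_digraph \<Delta> \<and> connected_digraph \<Delta> \<and> folded \<Delta> \<and> core_graph \<Delta> v \<and>
     (case subgroup_graph X K of (\<Gamma>, u) \<Rightarrow>
       \<exists>f g. digraph_morphism \<Gamma> \<Delta> f g \<and> f ` verts \<Gamma> = verts \<Delta> \<and> g ` arcs \<Gamma> = arcs \<Delta> \<and> f u = v))"

end

theory Submission
  imports Defs
begin

text \<open>
  Let \<open>K\<close> be generated by a finite symmetric set \<open>S\<close> and let \<open>K \<le> H\<close>. The image of \<open>\<Gamma>(K)\<close> in the Schreier
  graph of \<open>H\<close> is a subgraph \<open>\<Delta>\<close>, the part traversed by the words in \<open>S\<close>; its loops at the base point
  form a subgroup \<open>M\<close> with \<open>K \<le> M \<le> H\<close> and \<open>\<Delta> = \<Gamma>(M)\<close>. A spanning tree of \<open>\<Delta>\<close> extends to a spanning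
  tree of the Schreier graph, and the edges outside the tree give a free basis of \<open>H\<close> of which the
  edges of \<open>\<Delta>\<close> form a basis of \<open>M\<close>, so \<open>M\<close> is a free factor of \<open>H\<close>. If \<open>K \<le> H\<close> is algebraic, then
  \<open>M = H\<close>. Moreover \<open>M\<close> is generated by elements \<open>p q\<inverse>\<close> with \<open>p\<close>, \<open>q\<close> prefixes of words in \<open>S\<close>, which
  leaves finitely many possibilities for \<open>M\<close> when \<open>H\<close> varies. For (4), take a minimal free factor
  of \<open>H\<close> among these finitely many subgroups.
\<close>


section \<open>Free bases and free products\<close>

text \<open>The graph \<Delta> is never constructed: a vertex is a coset \<open>H #> g\<close>,
  named by any word \<open>g\<close> that leads to it, and an edge is a predicate on such a word and
  a letter. Digraphs enter only when \<Gamma>(K) and \<Gamma>(M) are compared, and there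
  surjectivity of the morphism becomes a condition on prefixes of words. Freeness occurs in two
  forms. Alternating sequences define the free product, but splitting off a factor and passing from
  a factor of a factor to a factor are easy only with bases. The equivalence
  \<open>free_basis_Un_iff\<close> translates in both directions; it rests on the fact that every
  subgroup of a free group has a basis. The subgroup \<open>H\<close> may have infinite index, so
  the spanning trees come from Zorn's lemma. The minimal free factor \<open>M\<close> in (4) is
  algebraic over \<open>K\<close> because the finite list of candidates depends on \<open>K\<close>
  only: a decomposition \<open>M = L * C\<close> with \<open>K\<close> inside \<open>L\<close>
  allows the construction to be repeated in \<open>L\<close>, and its result is a competitor of
  \<open>M\<close>.\<close>

definition letter_value :: "('g, 'm) monoid_scheme \<Rightarrow> 'g \<times> bool \<Rightarrow> 'g" where
  "letter_value G l = (if snd l then fst l else inv\<^bsub>G\<^esub> (fst l))"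

definition word_value :: "('g, 'm) monoid_scheme \<Rightarrow> ('g \<times> bool) list \<Rightarrow> 'g" where
  "word_value G w = foldr (\<lambda>l g. letter_value G l \<otimes>\<^bsub>G\<^esub> g) w \<one>\<^bsub>G\<^esub>"

text \<open>Surjectivity says that \<open>Y\<close> generates \<open>H\<close>, injectivity on
  reduced words that it does so freely. The letters are the group elements themselves, so when
  \<open>G\<close> is a free group the words over \<open>Y\<close> are lists of signed
  lists.\<close>

definition free_basis :: "('g, 'm) monoid_scheme \<Rightarrow> 'g set \<Rightarrow> 'g set \<Rightarrow> bool" where
  "free_basis G Y H \<longleftrightarrow> Y \<subseteq> carrier G \<and> bij_betw (word_value G) (carrier (free_group Y)) H"

lemma word_value_simps [simp]:
  "word_value G [] = \<one>\<^bsub>G\<^esub>"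
  "word_value G (l # w) = letter_value G l \<otimes>\<^bsub>G\<^esub> word_value G w"
  by (simp_all add: word_value_def)

lemma carrier_free_group_mono: "Y \<subseteq> Z \<Longrightarrow> carrier (free_group Y) \<subseteq> carrier (free_group Z)"
  by (auto simp: free_group_simps)

lemma Nil_in_free_group [simp]: "[] \<in> carrier (free_group X)"
  by (simp add: free_group_simps)

lemma Cons_in_free_group:
  "l # w \<in> carrier (free_group X) \<longleftrightarrow>
    fst l \<in> X \<and> (w = [] \<or> hd w \<noteq> flip l) \<and> w \<in> carrier (free_group X)"
  by (auto simp: free_group_simps reduced_Cons)

lemma reduced_append:
  "reduced (u @ w) \<longleftrightarrow>
    reduced u \<and> reduced w \<and> (u = [] \<or> w = [] \<or> hd w \<noteq> flip (last u))"
  by (auto simp: reduced_def successively_append_iff)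

context group
begin

lemma letter_value_closed: "fst l \<in> carrier G \<Longrightarrow> letter_value G l \<in> carrier G"
  by (simp add: letter_value_def)

lemma word_value_closed: "fst ` set w \<subseteq> carrier G \<Longrightarrow> word_value G w \<in> carrier G"
  by (induction w) (auto simp: letter_value_closed)

lemma letter_value_flip:
  "fst l \<in> carrier G \<Longrightarrow> letter_value G (flip l) = inv letter_value G l"
  by (simp add: letter_value_def flip_def)

lemma word_value_push:
  assumes "fst l \<in> carrier G" "fst ` set w \<subseteq> carrier G"
  shows "word_value G (push l w) = letter_value G l \<otimes> word_value G w"
proof (cases w)
  case (Cons m v)
  show ?thesis
  proof (cases "m = flip l")
    case True
    then have "letter_value G l \<otimes> word_value G w =
        letter_value G l \<otimes> (inv letter_value G l \<otimes> word_value G v)"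
      using Cons assms by (simp add: letter_value_flip)
    also have "\<dots> = word_value G v"
      using Cons assms by (simp add: m_assoc[symmetric] letter_value_closed word_value_closed)
    finally show ?thesis using Cons True by simp
  qed (use Cons in simp)
qed simp

lemma word_value_mult:
  assumes "fst ` set u \<subseteq> carrier G" "fst ` set w \<subseteq> carrier G"
  shows "word_value G (foldr push u w) = word_value G u \<otimes> word_value G w"
  using assms(1)
proof (induction u)
  case Nil
  then show ?case using assms(2) by (simp add: word_value_closed)
next
  case (Cons l u)
  moreover have "fst ` set (foldr push u w) \<subseteq> carrier G"
    using Cons.prems assms(2) set_foldr_push[of u w] by fastforce
  ultimately show ?case
    using assms(2) by (simp add: word_value_push m_assoc letter_value_closed word_value_closed)
qed

lemma word_value_hom:
  assumes "Y \<subseteq> carrier G"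
  shows "word_value G \<in> hom (free_group Y) G"
  using assms
  by (intro homI word_value_closed) (auto simp: free_group_simps intro!: word_value_mult)

lemma subgroup_word_value_image:
  assumes "Y \<subseteq> carrier G"
  shows "subgroup (word_value G ` carrier (free_group Y)) G"
proof -
  interpret F: group "free_group Y" by (rule group_free_group)
  interpret group_hom "free_group Y" G "word_value G"
    using word_value_hom[OF assms] is_group
    by (simp add: group_hom_def group_hom_axioms_def group_free_group)
  show ?thesis by (rule img_is_subgroup)
qed

lemma subgroup_if_free_basis: "free_basis G Y H \<Longrightarrow> subgroup H G"
  using subgroup_word_value_image[of Y] by (auto simp: free_basis_def bij_betw_def)

lemma free_basis_subset:
  assumes "free_basis G Y H" "Z \<subseteq> Y"
  shows "free_basis G Z (word_value G ` carrier (free_group Z))"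
  using assms carrier_free_group_mono[OF assms(2)]
  by (auto simp: free_basis_def bij_betw_def intro: inj_on_subset)

text \<open>The two factors of a free product meet only in the identity. Since basis elements are
  nontrivial members of their subgroup, bases of the two factors are disjoint, as the union of bases
  requires.\<close>

lemma free_basis_memD:
  assumes "free_basis G Y H" "y \<in> Y"
  shows "y \<in> H" "y \<noteq> \<one>"
proof -
  have w: "[(y, True)] \<in> carrier (free_group Y)" and y: "y \<in> carrier G"
    using assms by (auto simp: free_group_simps reduced_Cons free_basis_def)
  have v: "word_value G [(y, True)] = y" using y by (simp add: letter_value_def)
  show "y \<in> H" using assms w v by (metis bij_betw_apply free_basis_def)
  show "y \<noteq> \<one>"
  proof
    assume "y = \<one>"
    then have "word_value G [(y, True)] = word_value G []" using v by simp
    moreover have "inj_on (word_value G) (carrier (free_group Y))"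
      using assms by (simp add: free_basis_def bij_betw_def)
    ultimately have "[(y, True)] = ([] :: ('a \<times> bool) list)"
      using w Nil_in_free_group by (meson inj_onD)
    then show False by simp
  qed
qed

end

text \<open>
  A reduced word over a disjoint union splits uniquely into syllables; \<open>add_syllable\<close> prepends one
  letter to such a splitting.
\<close>

fun add_syllable ::
    "'a set \<Rightarrow> 'a \<times> bool \<Rightarrow> (('a \<times> bool) list + ('a \<times> bool) list) list \<Rightarrow>
      (('a \<times> bool) list + ('a \<times> bool) list) list" where
  "add_syllable Y l (Inl u # s) =
     (if fst l \<in> Y then Inl (l # u) # s else Inr [l] # Inl u # s)"
| "add_syllable Y l (Inr u # s) =
     (if fst l \<in> Y then Inl [l] # Inr u # s else Inr (l # u) # s)"
| "add_syllable Y l [] = (if fst l \<in> Y then [Inl [l]] else [Inr [l]])"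

abbreviation strip :: "'g + 'g \<Rightarrow> 'g" where
  "strip \<equiv> case_sum id id"

lemma evaluate_simps [simp]:
  "evaluate G [] = \<one>\<^bsub>G\<^esub>"
  "evaluate G (a # s) = strip a \<otimes>\<^bsub>G\<^esub> evaluate G s"
  by (simp_all add: evaluate_def)

lemma alternating_Nil [simp]: "[] \<in> alternating G A B"
  by (simp add: alternating_def)

lemma alternating_Cons:
  "a # s \<in> alternating G A B \<longleftrightarrow>
    a \<in> (A - {\<one>\<^bsub>G\<^esub>}) <+> (B - {\<one>\<^bsub>G\<^esub>}) \<and> s \<in> alternating G A B \<and>
    (s = [] \<or> isl (hd s) \<noteq> isl a)"
  by (cases s) (auto simp: alternating_def)

section \<open>Syllable normal form in the free group on a disjoint union\<close>

context
  fixes Y Z :: "'a set"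
  assumes YZ: "Y \<inter> Z = {}"
begin

private abbreviation alt where
  "alt \<equiv> alternating (free_group (Y \<union> Z)) (carrier (free_group Y)) (carrier (free_group Z))"

private lemma syllable_cases:
  assumes "a \<in> (carrier (free_group Y) - {\<one>\<^bsub>free_group (Y \<union> Z)\<^esub>}) <+>
      (carrier (free_group Z) - {\<one>\<^bsub>free_group (Y \<union> Z)\<^esub>})"
  shows "strip a \<noteq> [] \<and> reduced (strip a) \<and> fst ` set (strip a) \<subseteq> (if isl a then Y else Z)"
  using assms by (elim PlusE) (simp_all add: free_group_simps)

text \<open>Neighbouring syllables are written in disjoint alphabets, so nothing cancels where they
  meet and their product is plain concatenation.\<close>

private lemma evaluate_alternating:
  assumes "s \<in> alt"
  shows "evaluate (free_group (Y \<union> Z)) s = concat (map strip s) \<and> reduced (concat (map strip s)) \<and>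
    fst ` set (concat (map strip s)) \<subseteq> Y \<union> Z"
  using assms
proof (induction s)
  case (Cons a s)
  then have a: "strip a \<noteq> []" "reduced (strip a)" "fst ` set (strip a) \<subseteq> (if isl a then Y else Z)"
    and s: "s \<in> alt" and *: "s = [] \<or> isl (hd s) \<noteq> isl a"
    using syllable_cases[of a] by (auto simp: alternating_Cons)
  note IH = Cons.IH[OF s]
  have "reduced (strip a @ concat (map strip s))"
  proof (cases s)
    case (Cons b t)
    have b: "strip b \<noteq> []" "fst ` set (strip b) \<subseteq> (if isl b then Y else Z)"
      using syllable_cases[of b] s Cons by (auto simp: alternating_Cons)
    have "fst (hd (strip b)) \<in> (if isl b then Y else Z)" "fst (last (strip a)) \<in> (if isl a then Y else Z)"
      using b a hd_in_set[OF b(1)] last_in_set[OF a(1)] by blast+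
    then have "fst (hd (strip b)) \<noteq> fst (last (strip a))"
      using * Cons YZ by (auto split: if_splits)
    then show ?thesis using IH a b Cons by (auto simp: reduced_append)
  qed (use a in simp)
  then show ?case
    using IH a foldr_push_Nil[of "strip a @ concat (map strip s)"]
      foldr_push_Nil[of "concat (map strip s)"]
    by (auto simp: free_group_simps split: if_splits)
qed (simp add: free_group_simps)

private lemma add_syllable_alternating:
  assumes "s \<in> alt" "fst l \<in> Y \<union> Z" "reduced (l # concat (map strip s))"
  shows "add_syllable Y l s \<in> alt \<and> concat (map strip (add_syllable Y l s)) = l # concat (map strip s)"
proof (cases s)
  case Nil
  then show ?thesis using assms YZ
    by (auto simp: alternating_Cons Cons_in_free_group free_group_simps(3))
next
  case (Cons a t)
  have red: "reduced (l # strip a @ concat (map strip t))" using assms(3) Cons by simp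
  then have "reduced (l # strip a)" using reduced_append[of "l # strip a"] by simp
  then show ?thesis using assms(1,2) Cons YZ
    by (cases a) (auto simp: alternating_Cons Cons_in_free_group reduced_Cons free_group_simps(3))
qed

private lemma split_word:
  assumes "w \<in> carrier (free_group (Y \<union> Z))"
  shows "foldr (add_syllable Y) w [] \<in> alt \<and>
    concat (map strip (foldr (add_syllable Y) w [])) = w"
  using assms
proof (induction w)
  case (Cons l w)
  then have "fst l \<in> Y \<union> Z" "w \<in> carrier (free_group (Y \<union> Z))" "reduced (l # w)"
    using Cons.prems by (auto simp: free_group_simps reduced_Cons)
  then show ?case using Cons.IH add_syllable_alternating by simp
qed simp

text \<open>The last letter of the syllable is added first. It opens a new syllable because
  \<open>s\<close> starts with one of the other kind, and the remaining letters join it.\<close>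

private lemma add_syllables:
  assumes "a # s \<in> alt"
  shows "foldr (add_syllable Y) (strip a) s = a # s"
proof -
  have *: "s = [] \<or> isl (hd s) \<noteq> isl a" and a: "strip a \<noteq> []" "fst ` set (strip a) \<subseteq> (if isl a then Y else Z)"
    using assms syllable_cases[of a] by (auto simp: alternating_Cons)
  have "u \<noteq> [] \<Longrightarrow> fst ` set u \<subseteq> (if isl a then Y else Z) \<Longrightarrow>
      foldr (add_syllable Y) u s = (if isl a then Inl u else Inr u) # s" for u
  proof (induction u)
    case (Cons l u)
    show ?case
    proof (cases "u = []")
      case True
      then show ?thesis using Cons.prems * YZ
        by (cases "(Y, l, s)" rule: add_syllable.cases) auto
    next
      case False
      then show ?thesis using Cons YZ by auto
    qed
  qed simp
  from this[OF a] show ?thesis by (cases a) auto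
qed

private lemma split_concat:
  "s \<in> alt \<Longrightarrow> foldr (add_syllable Y) (concat (map strip s)) [] = s"
proof (induction s)
  case (Cons a s)
  then have "s \<in> alt" by (simp add: alternating_Cons)
  then show ?case using Cons add_syllables[of a s] by simp
qed simp

lemma bij_betw_evaluate_free_group:
  "bij_betw (evaluate (free_group (Y \<union> Z)))
     (alternating (free_group (Y \<union> Z)) (carrier (free_group Y)) (carrier (free_group Z)))
     (carrier (free_group (Y \<union> Z)))"
proof (rule bij_betw_byWitness[where f' = "\<lambda>w. foldr (add_syllable Y) w []"])
  show "\<forall>s\<in>alt. foldr (add_syllable Y) (evaluate (free_group (Y \<union> Z)) s) [] = s"
    using evaluate_alternating split_concat by simp
  show "\<forall>w\<in>carrier (free_group (Y \<union> Z)).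
      evaluate (free_group (Y \<union> Z)) (foldr (add_syllable Y) w []) = w"
    using split_word evaluate_alternating by metis
  show "evaluate (free_group (Y \<union> Z)) ` alt \<subseteq> carrier (free_group (Y \<union> Z))"
    using evaluate_alternating unfolding free_group_simps by (intro image_subsetI) simp
  show "(\<lambda>w. foldr (add_syllable Y) w []) ` carrier (free_group (Y \<union> Z)) \<subseteq> alt"
    using split_word by blast
qed

end

text \<open>Alternating sequences only distinguish trivial from nontrivial elements. The bijections
  of the factors therefore have to preserve the identity, but not products.\<close>

lemma bij_betw_map_alternating:
  assumes "bij_betw f A A'" "bij_betw g B B'"
    and "\<one>\<^bsub>G\<^esub> \<in> A" "\<one>\<^bsub>G\<^esub> \<in> B" "f \<one>\<^bsub>G\<^esub> = \<one>\<^bsub>G'\<^esub>" "g \<one>\<^bsub>G\<^esub> = \<one>\<^bsub>G'\<^esub>"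
  shows "bij_betw (map (map_sum f g)) (alternating G A B) (alternating G' A' B')"
proof (rule bij_betw_byWitness[where f' = "map (map_sum (inv_into A f) (inv_into B g))"])
  have f: "inv_into A f (f x) = x" "f x \<in> A'" "f x = \<one>\<^bsub>G'\<^esub> \<longleftrightarrow> x = \<one>\<^bsub>G\<^esub>" if "x \<in> A" for x
    using assms that inj_on_eq_iff[of f A x "\<one>\<^bsub>G\<^esub>"] by (auto simp: bij_betw_def)
  have g: "inv_into B g (g x) = x" "g x \<in> B'" "g x = \<one>\<^bsub>G'\<^esub> \<longleftrightarrow> x = \<one>\<^bsub>G\<^esub>" if "x \<in> B" for x
    using assms that inj_on_eq_iff[of g B x "\<one>\<^bsub>G\<^esub>"] by (auto simp: bij_betw_def)
  have f': "f (inv_into A f y) = y" "inv_into A f y \<in> A" "inv_into A f y = \<one>\<^bsub>G\<^esub> \<longleftrightarrow> y = \<one>\<^bsub>G'\<^esub>" if "y \<in> A'" for y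
    using assms that f by (auto simp: bij_betw_def f_inv_into_f inv_into_into)
  have g': "g (inv_into B g y) = y" "inv_into B g y \<in> B" "inv_into B g y = \<one>\<^bsub>G\<^esub> \<longleftrightarrow> y = \<one>\<^bsub>G'\<^esub>" if "y \<in> B'" for y
    using assms that g by (auto simp: bij_betw_def f_inv_into_f inv_into_into)
  have isl_map: "isl (map_sum h k a) = isl a" for a :: "'x + 'y" and h :: "'x \<Rightarrow> 'z" and k :: "'y \<Rightarrow> 'w"
    by (cases a) auto
  have m: "map_sum f g a \<in> (A' - {\<one>\<^bsub>G'\<^esub>}) <+> (B' - {\<one>\<^bsub>G'\<^esub>})"
    if "a \<in> (A - {\<one>\<^bsub>G\<^esub>}) <+> (B - {\<one>\<^bsub>G\<^esub>})" for a
    using that f g by (elim PlusE) auto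
  have m': "map_sum (inv_into A f) (inv_into B g) a \<in> (A - {\<one>\<^bsub>G\<^esub>}) <+> (B - {\<one>\<^bsub>G\<^esub>})"
    if "a \<in> (A' - {\<one>\<^bsub>G'\<^esub>}) <+> (B' - {\<one>\<^bsub>G'\<^esub>})" for a
    using that f' g' by (elim PlusE) auto
  have i: "map_sum (inv_into A f) (inv_into B g) (map_sum f g a) = a"
    if "a \<in> (A - {\<one>\<^bsub>G\<^esub>}) <+> (B - {\<one>\<^bsub>G\<^esub>})" for a
    using that f g by (elim PlusE) auto
  have i': "map_sum f g (map_sum (inv_into A f) (inv_into B g) a) = a"
    if "a \<in> (A' - {\<one>\<^bsub>G'\<^esub>}) <+> (B' - {\<one>\<^bsub>G'\<^esub>})" for a
    using that f' g' by (elim PlusE) auto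
  show "\<forall>s\<in>alternating G A B. map (map_sum (inv_into A f) (inv_into B g)) (map (map_sum f g) s) = s"
    unfolding map_map o_def using i by (auto simp: alternating_def intro!: map_idI)
  show "\<forall>s\<in>alternating G' A' B'. map (map_sum f g) (map (map_sum (inv_into A f) (inv_into B g)) s) = s"
    unfolding map_map o_def using i' by (auto simp: alternating_def intro!: map_idI)
  show "map (map_sum f g) ` alternating G A B \<subseteq> alternating G' A' B'"
    by (auto simp: alternating_def successively_map isl_map intro!: m)
  show "map (map_sum (inv_into A f) (inv_into B g)) ` alternating G' A' B' \<subseteq> alternating G A B"
    by (auto simp: alternating_def successively_map isl_map intro!: m')
qed

section \<open>Bases and internal free products\<close>

context group
begin

text \<open>Both sides assert bijectivity of the same map on syllable sequences. Joining the
  syllables to a reduced word and taking its value agrees with taking the value of each syllable in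
  \<open>A\<close> or \<open>B\<close> and multiplying in \<open>G\<close>; the maps
  \<open>e\<close> and \<open>m\<close> in front are bijections anyway.\<close>

lemma free_basis_Un_iff:
  assumes Y: "free_basis G Y A" and Z: "free_basis G Z B" and YZ: "Y \<inter> Z = {}"
  shows "free_basis G (Y \<union> Z) H \<longleftrightarrow> internal_free_product G H A B"
proof -
  let ?F = "free_group (Y \<union> Z)" and ?m = "map (map_sum (word_value G) (word_value G))"
  let ?alt = "alternating ?F (carrier (free_group Y)) (carrier (free_group Z))"
  have c: "Y \<union> Z \<subseteq> carrier G" using Y Z by (auto simp: free_basis_def)
  have m: "bij_betw ?m ?alt (alternating G A B)"
    using Y Z by (intro bij_betw_map_alternating) (auto simp: free_basis_def free_group_simps)
  have e: "bij_betw (evaluate ?F) ?alt (carrier ?F)"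
    by (rule bij_betw_evaluate_free_group[OF YZ])
  have *: "fst ` set (evaluate ?F s) \<subseteq> Y \<union> Z \<and>
      word_value G (evaluate ?F s) = evaluate G (?m s)" if "s \<in> ?alt" for s
    using that
  proof (induction s)
    case (Cons a s)
    then have "a \<in> carrier (free_group Y) <+> carrier (free_group Z)"
      and IH: "fst ` set (evaluate ?F s) \<subseteq> Y \<union> Z" "word_value G (evaluate ?F s) = evaluate G (?m s)"
      by (auto simp: alternating_Cons)
    then have a: "fst ` set (strip a) \<subseteq> Y \<union> Z"
      by (elim PlusE) (simp_all add: free_group_simps le_supI1 le_supI2)
    have "strip (map_sum (word_value G) (word_value G) a) = word_value G (strip a)"
      by (cases a) auto
    moreover have "evaluate ?F (a # s) = foldr push (strip a) (evaluate ?F s)"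
      by (simp add: free_group_simps)
    moreover have "fst ` set (foldr push (strip a) (evaluate ?F s)) \<subseteq> Y \<union> Z"
      using image_mono[OF set_foldr_push] Un_least[OF a IH(1)] unfolding image_Un[symmetric]
      by (rule order_trans)
    ultimately show ?case
      using word_value_mult[OF order_trans[OF a c] order_trans[OF IH(1) c]] IH(2) by simp
  qed (simp add: free_group_simps)
  have "bij_betw (word_value G) (carrier ?F) H \<longleftrightarrow> bij_betw (word_value G \<circ> evaluate ?F) ?alt H"
    by (rule bij_betw_comp_iff[OF e])
  also have "\<dots> \<longleftrightarrow> bij_betw (evaluate G \<circ> ?m) ?alt H"
    using * by (intro bij_betw_cong) simp
  also have "\<dots> \<longleftrightarrow> bij_betw (evaluate G) (alternating G A B) H"
    by (rule bij_betw_comp_iff[OF m, symmetric])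
  finally show ?thesis
    using Y Z c subgroup_if_free_basis[of "Y \<union> Z" H] subgroup_if_free_basis[OF Y]
      subgroup_if_free_basis[OF Z]
      subgroup_word_value_image[OF c]
    by (auto simp: internal_free_product_def free_basis_def)
qed

lemma internal_free_product_disjoint:
  assumes "internal_free_product G H A B" "x \<in> A" "x \<in> B"
  shows "x = \<one>"
proof (rule ccontr)
  assume "x \<noteq> \<one>"
  then have "[Inl x] \<in> alternating G A B" "[Inr x] \<in> alternating G A B"
    using assms by (auto simp: alternating_def)
  then have "[Inl x] = ([Inr x] :: ('a + 'a) list)"
    using assms(1) unfolding internal_free_product_def bij_betw_def
    by (elim conjE, elim inj_onD) simp_all
  then show False by simp
qed

lemma internal_free_product_subset:
  assumes "internal_free_product G H A B"
  shows "A \<subseteq> H" "B \<subseteq> H"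
proof -
  have H: "\<one> \<in> H" "A \<subseteq> carrier G" "B \<subseteq> carrier G"
    using assms unfolding internal_free_product_def
    by (meson subgroup.one_closed subgroup.subset)+
  have e: "evaluate G s \<in> H" if "s \<in> alternating G A B" for s
    using assms that unfolding internal_free_product_def by (meson bij_betw_apply)
  have "x \<in> H" if x: "x \<in> A" for x
  proof (cases "x = \<one>")
    case False
    then have "[Inl x] \<in> alternating G A B" using x by (auto simp: alternating_def)
    then show ?thesis using e[of "[Inl x]"] x H by auto
  qed (use H in simp)
  moreover have "x \<in> H" if x: "x \<in> B" for x
  proof (cases "x = \<one>")
    case False
    then have "[Inr x] \<in> alternating G A B" using x by (auto simp: alternating_def)
    then show ?thesis using e[of "[Inr x]"] x H by auto
  qed (use H in simp)
  ultimately show "A \<subseteq> H" "B \<subseteq> H" by blast+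
qed

lemma internal_free_product_trivial:
  assumes "internal_free_product G H A {\<one>}"
  shows "H = A"
proof
  have A: "subgroup A G" using assms by (simp add: internal_free_product_def)
  have *: "evaluate G s \<in> A" if "s \<in> alternating G A {\<one>}" for s
    using that
    by (induction s)
      (auto simp: alternating_Cons subgroup.one_closed[OF A] subgroup.m_closed[OF A])
  then show "H \<subseteq> A" using assms by (auto simp: internal_free_product_def bij_betw_def)
qed (rule internal_free_product_subset(1)[OF assms])

text \<open>The remaining basis elements \<open>Y - Z\<close> generate the complementary
  factor.\<close>

lemma free_factor_if_free_basis:
  assumes "free_basis G Y H" "Z \<subseteq> Y"
  shows "free_factor G (word_value G ` carrier (free_group Z)) H"
proof -
  have "free_basis G (Z \<union> (Y - Z)) H" using assms by (simp add: Un_absorb1)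
  then show ?thesis
    using free_basis_Un_iff[OF free_basis_subset[OF assms] free_basis_subset[OF assms(1), of "Y - Z"]]
    by (auto simp: free_factor_def)
qed

text \<open>Transitivity holds for free groups since bases of the factors unite to a basis.\<close>

lemma free_factor_trans:
  assumes basis: "\<And>A. subgroup A G \<Longrightarrow> \<exists>Y. free_basis G Y A"
    and "free_factor G A B" "free_factor G B H"
  shows "free_factor G A H"
proof -
  obtain A' B' where A': "internal_free_product G B A A'" and B': "internal_free_product G H B B'"
    using assms(2,3) by (auto simp: free_factor_def)
  obtain Y Y' Z where Y: "free_basis G Y A" "free_basis G Y' A'" "free_basis G Z B'"
    using basis A' B' unfolding internal_free_product_def by meson
  have "Y \<inter> Y' = {}"
    using internal_free_product_disjoint[OF A'] free_basis_memD[OF Y(1)] free_basis_memD[OF Y(2)]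
    by blast
  then have B: "free_basis G (Y \<union> Y') B"
    using free_basis_Un_iff[OF Y(1,2)] A' by blast
  have "(Y \<union> Y') \<inter> Z = {}"
    using internal_free_product_disjoint[OF B'] free_basis_memD[OF B] free_basis_memD[OF Y(3)]
    by blast
  then have "free_basis G (Y \<union> Y' \<union> Z) H"
    using free_basis_Un_iff[OF B Y(3)] B' by blast
  then have "free_factor G (word_value G ` carrier (free_group Y)) H"
    by (rule free_factor_if_free_basis) auto
  then show ?thesis using Y(1) by (simp add: free_basis_def bij_betw_def)
qed

end


lemma foldr_push_in_free_group:
  assumes "fst ` set u \<subseteq> X" "w \<in> carrier (free_group X)"
  shows "foldr push u w \<in> carrier (free_group X)"
proof -
  have "fst ` set (foldr push u w) \<subseteq> fst ` (set u \<union> set w)"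
    by (intro image_mono set_foldr_push)
  also have "\<dots> \<subseteq> X" using assms by (simp add: image_Un free_group_simps)
  finally show ?thesis using assms by (simp add: free_group_simps reduced_foldr_push)
qed

section \<open>The subgroup read off a part of a Schreier graph\<close>

locale free_group_subgroup =
  fixes X :: "'a set" and G (structure) and H
  defines G_def: "G \<equiv> free_group X"
  assumes H: "subgroup H G"
begin

sublocale group G
  unfolding G_def by (rule group_free_group)

lemma in_carrier: "w \<in> carrier G \<longleftrightarrow> reduced w \<and> fst ` set w \<subseteq> X"
  by (simp add: G_def free_group_simps)

lemma mult_eq: "u \<otimes> w = foldr push u w"
  by (simp add: G_def free_group_simps)

lemma one_eq: "\<one> = []"
  by (simp add: G_def free_group_simps)

lemma Nil_closed [simp]: "[] \<in> carrier G"
  by (simp add: in_carrier)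

lemma mult_Nil [simp]: "g \<in> carrier G \<Longrightarrow> g \<otimes> [] = g"
  using r_one by (simp add: one_eq)

lemma Nil_mult [simp]: "[] \<otimes> g = g"
  by (simp add: mult_eq)

lemma inv_Nil [simp]: "inv [] = []"
  using inv_one by (simp add: one_eq)

lemma letter_closed [simp]: "[l] \<in> carrier G \<longleftrightarrow> fst l \<in> X"
  by (simp add: in_carrier reduced_Cons)

lemma append_closedD: "u @ w \<in> carrier G \<Longrightarrow> u \<in> carrier G \<and> w \<in> carrier G"
  by (auto simp: in_carrier reduced_append)

lemma append_eq_mult: "u @ w \<in> carrier G \<Longrightarrow> u @ w = u \<otimes> w"
  using foldr_push_Nil[of "u @ w"] foldr_push_Nil[of w]
  by (simp add: mult_eq in_carrier reduced_append)

lemma Cons_closedD: "l # w \<in> carrier G \<Longrightarrow> fst l \<in> X \<and> w \<in> carrier G"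
  using append_closedD[of "[l]" w] by simp

lemma Cons_eq_mult: "l # w \<in> carrier G \<Longrightarrow> l # w = [l] \<otimes> w"
  using append_eq_mult[of "[l]" w] by simp

lemma split_closedD:
  assumes "p @ l # q \<in> carrier G"
  shows "p \<in> carrier G" "fst l \<in> X" "q \<in> carrier G" "p @ [l] \<in> carrier G" "p @ [l] = p \<otimes> [l]"
    "p @ l # q = p \<otimes> [l] \<otimes> q"
proof -
  show *: "p \<in> carrier G" "fst l \<in> X" "q \<in> carrier G" "p @ [l] \<in> carrier G"
    using assms append_closedD[of p "l # q"] append_closedD[of "p @ [l]" q] Cons_closedD[of l q] by auto
  show pl: "p @ [l] = p \<otimes> [l]" using * by (intro append_eq_mult)
  have "p @ l # q = (p @ [l]) @ q" by simp
  also have "\<dots> = (p @ [l]) \<otimes> q" using assms by (intro append_eq_mult) simp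
  finally show "p @ l # q = p \<otimes> [l] \<otimes> q" unfolding pl .
qed

lemma inv_letter: "fst l \<in> X \<Longrightarrow> inv [l] = [flip l]"
  by (rule inv_equality) (simp_all add: mult_eq one_eq)

lemma inv_eq: "w \<in> carrier G \<Longrightarrow> inv w = rev (map flip w)"
  using foldr_push_inverse[of "[]" w] reduced_rev_map_flip[of w]
  by (intro inv_equality) (auto simp: mult_eq one_eq in_carrier foldr_push_Nil image_image)

lemma mult_flip [simp]:
  assumes "g \<in> carrier G" "fst l \<in> X"
  shows "g \<otimes> [l] \<otimes> [flip l] = g"
  using assms r_inv[of "[l]"] by (simp add: m_assoc inv_letter)

lemma H_closed: "h \<in> H \<Longrightarrow> h \<in> carrier G"
  using subgroup.mem_carrier[OF H] .

lemma coset_mult_mult: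
  "g \<in> carrier G \<Longrightarrow> a \<in> carrier G \<Longrightarrow> H #> (g \<otimes> a) = (H #> g) #> a"
  using subgroup.subset[OF H] by (simp add: coset_mult_assoc)

lemma coset_cong:
  assumes "H #> g = H #> g'" "g \<in> carrier G" "g' \<in> carrier G" "a \<in> carrier G"
  shows "H #> (g \<otimes> a) = H #> (g' \<otimes> a)"
  using assms by (simp add: coset_mult_mult)

lemma coset_eq_iff:
  assumes "g \<in> carrier G" "g' \<in> carrier G"
  shows "H #> g = H #> g' \<longleftrightarrow> g \<otimes> inv g' \<in> H"
proof
  assume "H #> g = H #> g'"
  then have "H #> (g \<otimes> inv g') = H"
    using assms subgroup.subset[OF H]
    by (simp add: coset_mult_mult coset_mult_inv2)
  then show "g \<otimes> inv g' \<in> H"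
    using coset_join1[OF _ _ H, of "g \<otimes> inv g'"] assms subgroup.subset[OF H] by simp
next
  assume "g \<otimes> inv g' \<in> H"
  then have "H #> (g \<otimes> inv g') = H" using coset_join2[OF _ H] assms by simp
  then have "(H #> (g \<otimes> inv g')) #> g' = H #> g'" by simp
  then show "H #> g = H #> g'"
    using assms by (simp add: coset_mult_mult[symmetric] m_assoc)
qed

lemma coset_mult_left:
  assumes "h \<in> H" "g \<in> carrier G"
  shows "H #> (h \<otimes> g) = H #> g"
  using assms H_closed by (simp add: coset_eq_iff m_assoc)

lemma coset_eq_H_iff: "g \<in> carrier G \<Longrightarrow> H #> g = H #> \<one> \<longleftrightarrow> g \<in> H"
  by (simp add: coset_eq_iff)

text \<open>
  Prefix closed sets of coset representatives are the subtrees of the Schreier graph that contain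
  the base point.
\<close>

definition partial_transversal where
  "partial_transversal R \<longleftrightarrow> R \<subseteq> carrier G \<and> [] \<in> R \<and>
     (\<forall>p l. p @ [l] \<in> R \<longrightarrow> p \<in> R) \<and> inj_on (\<lambda>r. H #> r) R"

text \<open>Here \<open>W\<close> consists of the reduced words that can be read from the base point
  inside a subgraph; \<open>step\<close> expresses that the letters allowed next depend only on the
  vertex reached. A maximal subtree reaches every vertex of the subgraph, since otherwise a path to
  a missed vertex would leave it through an edge that could be added. This serves both for the
  subgraph, starting from the base point, and for the whole Schreier graph, starting from the tree
  of the subgraph.\<close>

lemma extend_transversal:
  assumes W: "W \<subseteq> carrier G" "\<And>p l. p @ [l] \<in> W \<Longrightarrow> p \<in> W"
    and step: "\<And>w l r. w @ [l] \<in> W \<Longrightarrow> r \<in> W \<Longrightarrow> H #> w = H #> r \<Longrightarrow>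
      reduced (r @ [l]) \<Longrightarrow> r @ [l] \<in> W"
    and R0: "partial_transversal R0" "R0 \<subseteq> W"
  shows "\<exists>R. partial_transversal R \<and> R0 \<subseteq> R \<and> R \<subseteq> W \<and> (\<forall>w\<in>W. \<exists>r\<in>R. H #> w = H #> r)"
proof -
  define A where "A = {R. partial_transversal R \<and> R0 \<subseteq> R \<and> R \<subseteq> W}"
  have "\<exists>M\<in>A. \<forall>R\<in>A. M \<subseteq> R \<longrightarrow> R = M"
  proof (rule subset_Zorn_nonempty)
    show "A \<noteq> {}" using R0 by (auto simp: A_def)
    fix \<C> assume \<C>: "\<C> \<noteq> {}" "subset.chain A \<C>"
    have AC: "R \<in> A" if "R \<in> \<C>" for R using \<C>(2) that by (auto simp: subset.chain_def)
    have "inj_on (\<lambda>r. H #> r) (\<Union>\<C>)"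
    proof (rule inj_onI)
      fix r s assume "r \<in> \<Union>\<C>" "s \<in> \<Union>\<C>" and eq: "H #> r = H #> s"
      then obtain R where "R \<in> \<C>" "r \<in> R" "s \<in> R"
        using subset.chain_total[OF \<C>(2)] by blast
      then show "r = s" using AC eq by (auto simp: A_def partial_transversal_def dest: inj_onD)
    qed
    moreover have "p \<in> \<Union>\<C>" if "p @ [l] \<in> \<Union>\<C>" for p l
      using that AC unfolding A_def partial_transversal_def by blast
    ultimately show "\<Union>\<C> \<in> A"
      using \<C>(1) AC unfolding A_def partial_transversal_def by blast
  qed
  then obtain R where "R \<in> A" and max: "\<And>S. S \<in> A \<Longrightarrow> R \<subseteq> S \<Longrightarrow> S = R" by blast
  have R: "R \<subseteq> carrier G" "[] \<in> R" "\<And>p l. p @ [l] \<in> R \<Longrightarrow> p \<in> R" "inj_on (\<lambda>r. H #> r) R"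
    "R0 \<subseteq> R" "R \<subseteq> W"
    using \<open>R \<in> A\<close> unfolding A_def partial_transversal_def by blast+
  \<comment> \<open>Maximality: if \<open>l\<close> led from \<open>r\<close> to a vertex outside
    the tree, the word \<open>r @ [l]\<close> could be added as its representative.\<close>
  have ext: "\<exists>r'\<in>R. H #> (r @ [l]) = H #> r'" if r: "r \<in> R" "r @ [l] \<in> W" for r l
  proof (rule ccontr)
    assume *: "\<not> ?thesis"
    have "inj_on (\<lambda>r. H #> r) (insert (r @ [l]) R)"
      using R(4) * unfolding inj_on_insert by blast
    then have "insert (r @ [l]) R \<in> A"
      using R r W by (auto simp: A_def partial_transversal_def)
    then have "insert (r @ [l]) R = R" using max by blast
    then show False using * by blast
  qed
  have "\<exists>r\<in>R. H #> w = H #> r" if "w \<in> W" for w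
    using that
  proof (induction w rule: rev_induct)
    case Nil
    then show ?case using R(2) by blast
  next
    case (snoc l w)
    then have w: "w \<in> carrier G" "fst l \<in> X" "w @ [l] = w \<otimes> [l]"
      using W append_closedD[of w "[l]"] append_eq_mult[of w "[l]"] by auto
    obtain r where r: "r \<in> R" "H #> w = H #> r"
      using snoc W(2) by blast
    have rc: "r \<in> carrier G" using r R by blast
    have eq: "H #> (w @ [l]) = H #> (r \<otimes> [l])"
      using coset_cong[OF r(2)] w rc by simp
    show ?case
    proof (cases "reduced (r @ [l])")
      case True
      then have rl: "r @ [l] \<in> W" using step snoc.prems r R(6) by blast
      then have "r @ [l] = r \<otimes> [l]" using append_eq_mult W(1) by blast
      then show ?thesis using ext[OF r(1) rl] eq by simp
    next
      \<comment> \<open>The letter \<open>l\<close> runs back along the last edge of the tree path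
        to \<open>r\<close>, so it ends at the parent \<open>r'\<close>, which is in the
        tree.\<close>
      case False
      then have "r \<noteq> []" "last r = flip l"
        using rc by (auto simp: reduced_append reduced_Cons in_carrier)
      then obtain r' where r': "r = r' @ [flip l]" by (metis append_butlast_last_id)
      then have "r' \<in> R" using r R(3) by blast
      moreover have "r = r' \<otimes> [flip l]" using append_eq_mult rc r' by blast
      then have "r \<otimes> [l] = r'"
        using mult_flip[of r' "flip l"] R(1) \<open>r' \<in> R\<close> w by auto
      ultimately show ?thesis using eq by auto
    qed
  qed
  then show ?thesis using \<open>R \<in> A\<close> by (auto simp: A_def)
qed

end

section \<open>Schreier generators and Reidemeister-Schreier rewriting\<close>

locale transversal = free_group_subgroup +
  fixes R
  assumes transversal: "partial_transversal R" "\<And>g. g \<in> carrier G \<Longrightarrow> \<exists>r\<in>R. H #> g = H #> r"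
begin

definition rep where "rep g = (THE r. r \<in> R \<and> H #> r = H #> g)"

lemma rep: "g \<in> carrier G \<Longrightarrow> rep g \<in> R \<and> H #> rep g = H #> g"
  unfolding rep_def
proof (rule theI')
  assume "g \<in> carrier G"
  then obtain r where r: "r \<in> R" "H #> g = H #> r" using transversal(2) by blast
  have "inj_on (\<lambda>r. H #> r) R" using transversal(1) by (simp add: partial_transversal_def)
  then show "\<exists>!r. r \<in> R \<and> H #> r = H #> g"
    using r by (intro ex1I[of _ r]) (auto dest: inj_onD)
qed

lemma rep_closed [simp]: "g \<in> carrier G \<Longrightarrow> rep g \<in> carrier G"
  using rep transversal(1) by (auto simp: partial_transversal_def)

lemma R_closed: "r \<in> R \<Longrightarrow> r \<in> carrier G"
  using transversal(1) by (auto simp: partial_transversal_def)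

lemma inj_on_R: "inj_on (\<lambda>r. H #> r) R"
  using transversal(1) by (simp add: partial_transversal_def)

lemma rep_eq:
  assumes "r \<in> R" shows "rep r = r"
  using inj_onD[OF inj_on_R, of "rep r" r] rep[OF R_closed[OF assms]] assms by blast

lemma rep_cong: "H #> g = H #> g' \<Longrightarrow> rep g = rep g'"
  by (simp add: rep_def)

lemma rep_H: "h \<in> H \<Longrightarrow> rep h = \<one>"
  using rep_cong[of h \<one>] rep_eq[of "[]"] transversal(1) coset_eq_H_iff[of h] H_closed
  by (simp add: one_eq partial_transversal_def)

text \<open>The Schreier generator of an edge: along the tree to the vertex \<open>H #> g\<close>,
  across the edge labelled \<open>l\<close>, and back along the tree.\<close>

definition gen where "gen g l = rep g \<otimes> [l] \<otimes> inv rep (g \<otimes> [l])"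

definition gens where "gens = {gen g (x, True) | g x. g \<in> carrier G \<and> x \<in> X} - {\<one>}"

text \<open>
  Rewriting along a path from the vertex \<open>H #> g\<close>: an edge in the spanning tree contributes nothing,
  any other edge the letter for its generator. As \<open>gens\<close> only contains the generators of positive
  edges, an inverse edge contributes the inverse letter.
\<close>

definition crossing where
  "crossing g l = (if gen g l = \<one> then []
     else if snd l then [(gen g l, True)] else [(inv gen g l, False)])"

primrec crossings where
  "crossings g [] = []"
| "crossings g (l # w) = foldr push (crossing g l) (crossings (g \<otimes> [l]) w)"

lemma gen_closed: "g \<in> carrier G \<Longrightarrow> fst l \<in> X \<Longrightarrow> gen g l \<in> carrier G"
  by (simp add: gen_def)

lemma gen_cong:
  assumes "H #> g = H #> g'" "g \<in> carrier G" "g' \<in> carrier G" "fst l \<in> X"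
  shows "gen g l = gen g' l"
  using rep_cong[OF assms(1)] rep_cong[OF coset_cong[OF assms(1), of "[l]"]] assms
  by (simp add: gen_def)

lemma gen_in_H:
  assumes "g \<in> carrier G" "fst l \<in> X"
  shows "gen g l \<in> H"
proof -
  have "H #> (rep g \<otimes> [l]) = H #> rep (g \<otimes> [l])"
    using assms coset_cong[of "rep g" g "[l]"] rep by simp
  then show ?thesis using assms unfolding gen_def by (simp add: coset_eq_iff)
qed

lemma gen_flip:
  assumes "g \<in> carrier G" "fst l \<in> X"
  shows "gen (g \<otimes> [l]) (flip l) = inv gen g l"
  unfolding gen_def mult_flip[OF assms]
  using assms by (simp add: inv_mult_group inv_letter m_assoc)

lemma crossing_flip:
  assumes "g \<in> carrier G" "fst l \<in> X"
  shows "crossing (g \<otimes> [l]) (flip l) = rev (map flip (crossing g l))"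
  using assms gen_closed[OF assms]
  by (auto simp: crossing_def gen_flip) (auto simp: flip_def)

lemma crossing_cong:
  assumes "H #> g = H #> g'" "g \<in> carrier G" "g' \<in> carrier G" "fst l \<in> X"
  shows "crossing g l = crossing g' l"
  using gen_cong[OF assms] by (simp add: crossing_def)

lemma gens_closed: "gens \<subseteq> carrier G"
  by (auto simp: gens_def gen_closed)

text \<open>An inverse edge is a positive edge read from its other end, so its generator is the
  inverse of an element of \<open>gens\<close>, unless it is trivial.\<close>

lemma crossing_in_gens:
  assumes "g \<in> carrier G" "fst l \<in> X"
  shows "fst ` set (crossing g l) \<subseteq> gens"
proof (cases l)
  case (Pair x b)
  show ?thesis
  proof (cases b)
    case True
    then show ?thesis using assms Pair by (auto simp: crossing_def gens_def)
  next
    case False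
    have "inv gen g l = gen (g \<otimes> [l]) (x, True)" "g \<otimes> [l] \<in> carrier G" "x \<in> X"
      using gen_flip[OF assms] assms Pair False by (simp_all add: flip_def)
    then have "inv gen g l \<in> insert \<one> gens" unfolding gens_def by blast
    then show ?thesis using gen_closed[OF assms] Pair False by (auto simp: crossing_def)
  qed
qed

lemma reduced_crossing: "reduced (crossing g l)"
  by (simp add: crossing_def reduced_Cons)

lemma word_value_crossing:
  assumes "g \<in> carrier G" "fst l \<in> X"
  shows "word_value G (crossing g l) = gen g l"
  using gen_closed[OF assms] by (simp add: crossing_def letter_value_def)

lemma reduced_crossings: "reduced (crossings g w)"
  by (induction w arbitrary: g) (simp_all add: reduced_foldr_push)

text \<open>Cancellation creates no letters, so the alphabet of the rewritten word is controlled
  edge by edge. It is applied with all generators as \<open>Z\<close>, and with those in a smaller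
  subgroup.\<close>

lemma crossings_in:
  assumes "g \<in> carrier G" "w \<in> carrier G"
    and "\<And>p l q. w = p @ l # q \<Longrightarrow> fst ` set (crossing (g \<otimes> p) l) \<subseteq> Z"
  shows "crossings g w \<in> carrier (free_group Z)"
  using assms
proof (induction w arbitrary: g)
  case (Cons l w)
  have l: "fst l \<in> X" "w \<in> carrier G" using Cons_closedD Cons.prems(2) by auto
  have "fst ` set (crossing g l) \<subseteq> Z"
    using Cons.prems(3)[of "[]" l w] Cons.prems(1) by (simp add: one_eq)
  moreover have "crossings (g \<otimes> [l]) w \<in> carrier (free_group Z)"
  proof (rule Cons.IH)
    fix p m q assume w: "w = p @ m # q"
    have "(l # p) @ m # q \<in> carrier G" using Cons.prems(2) w by simp
    then have "l # p \<in> carrier G" using append_closedD by blast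
    then have "g \<otimes> (l # p) = g \<otimes> [l] \<otimes> p"
      using Cons_eq_mult[of l p] Cons_closedD[of l p] Cons.prems(1) by (simp add: m_assoc)
    then show "fst ` set (crossing (g \<otimes> [l] \<otimes> p) m) \<subseteq> Z"
      using Cons.prems(3)[of "l # p" m q] w by simp
  qed (use Cons.prems l in simp_all)
  ultimately show ?case by (simp add: foldr_push_in_free_group)
qed simp

lemma crossings_in_gens:
  assumes "g \<in> carrier G" "w \<in> carrier G"
  shows "crossings g w \<in> carrier (free_group gens)"
proof (rule crossings_in[OF assms])
  fix p l q assume "w = p @ l # q"
  then have "p \<in> carrier G" "fst l \<in> X"
    using assms(2) append_closedD[of p "l # q"] Cons_closedD[of l q] by auto
  then show "fst ` set (crossing (g \<otimes> p) l) \<subseteq> gens"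
    using assms(1) by (intro crossing_in_gens) auto
qed

lemma crossings_letters_closed:
  assumes "g \<in> carrier G" "w \<in> carrier G"
  shows "fst ` set (crossings g w) \<subseteq> carrier G"
  using crossings_in_gens[OF assms] gens_closed by (auto simp: free_group_simps)

text \<open>Rewriting respects free reduction: an edge and its inverse contribute mutually inverse
  words.\<close>

lemma crossings_push:
  assumes "g \<in> carrier G" "fst l \<in> X"
  shows "crossings g (push l w) = foldr push (crossing g l) (crossings (g \<otimes> [l]) w)"
proof (cases w)
  case (Cons m v)
  show ?thesis
  proof (cases "m = flip l")
    case True
    have "foldr push (rev (map flip (rev (map flip (crossing g l)))))
        (foldr push (rev (map flip (crossing g l))) (crossings g v)) = crossings g v"
      by (rule foldr_push_inverse[OF reduced_crossings])
    then show ?thesis using Cons True assms by (simp add: crossing_flip rev_map o_def)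
  qed (use Cons in simp)
qed simp

text \<open>A cocycle rule: the second factor is rewritten from the vertex where the first one ends.
  On \<open>H\<close>, whose elements return to the base point, it becomes multiplicativity.\<close>

lemma crossings_mult:
  assumes "g \<in> carrier G" "u \<in> carrier G" "w \<in> carrier G"
  shows "crossings g (u \<otimes> w) = foldr push (crossings g u) (crossings (g \<otimes> u) w)"
  using assms(1,2)
proof (induction u arbitrary: g)
  case Nil
  then show ?case using assms by (simp add: one_eq)
next
  case (Cons l u)
  then have l: "fst l \<in> X" "u \<in> carrier G" "l # u = [l] \<otimes> u"
    using Cons_closedD Cons_eq_mult by blast+
  have "(l # u) \<otimes> w = push l (u \<otimes> w)" by (simp add: mult_eq)
  then have "crossings g ((l # u) \<otimes> w) =
      foldr push (crossing g l) (crossings (g \<otimes> [l]) (u \<otimes> w))"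
    using crossings_push[OF Cons.prems(1) l(1)] by simp
  also have "crossings (g \<otimes> [l]) (u \<otimes> w) =
      foldr push (crossings (g \<otimes> [l]) u) (crossings (g \<otimes> [l] \<otimes> u) w)"
    using Cons l by simp
  also have "g \<otimes> [l] \<otimes> u = g \<otimes> (l # u)" using l Cons.prems by (simp add: m_assoc)
  finally show ?case by (simp add: foldr_push_assoc reduced_crossings)
qed

lemma crossings_cong:
  assumes "H #> g = H #> g'" "g \<in> carrier G" "g' \<in> carrier G" "w \<in> carrier G"
  shows "crossings g w = crossings g' w"
  using assms
proof (induction w arbitrary: g g')
  case (Cons l w)
  have l: "fst l \<in> X" "w \<in> carrier G" using Cons_closedD Cons.prems(4) by auto
  then show ?case
    using Cons.IH[OF coset_cong[OF Cons.prems(1)], of "[l]"] crossing_cong[OF Cons.prems(1)] Cons.prems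
    by simp
qed simp

text \<open>The product telescopes: the return along the tree in one generator cancels against the
  way out in the next, and only the two outermost tree paths survive. For a loop at the base point
  these are trivial as well.\<close>

lemma word_value_crossings:
  assumes "g \<in> carrier G" "w \<in> carrier G"
  shows "word_value G (crossings g w) = rep g \<otimes> w \<otimes> inv rep (g \<otimes> w)"
  using assms
proof (induction w arbitrary: g)
  case Nil
  then show ?case by (simp add: one_eq)
next
  case (Cons l w)
  then have l: "fst l \<in> X" "w \<in> carrier G" "l # w = [l] \<otimes> w"
    using Cons_closedD Cons_eq_mult by blast+
  have gl: "g \<otimes> [l] \<in> carrier G" using Cons.prems l by simp
  have "word_value G (crossings g (l # w)) =
      gen g l \<otimes> (rep (g \<otimes> [l]) \<otimes> w \<otimes> inv rep (g \<otimes> [l] \<otimes> w))"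
    using word_value_mult[OF order_trans[OF crossing_in_gens[OF Cons.prems(1) l(1)] gens_closed]
        crossings_letters_closed[OF gl l(2)]]
      Cons.IH[OF gl l(2)] word_value_crossing[OF Cons.prems(1) l(1)]
    by simp
  also have "\<dots> = rep g \<otimes> ([l] \<otimes> w) \<otimes> inv rep (g \<otimes> ([l] \<otimes> w))"
    using Cons.prems l by (simp add: gen_def m_assoc inv_solve_left')
  finally show ?case using l(3) by simp
qed

text \<open>By prefix closure every edge on the way to \<open>r\<close> joins two representatives,
  so its generator is trivial.\<close>

lemma crossings_rep:
  assumes "r \<in> R"
  shows "crossings [] r = []"
  using assms
proof (induction r rule: rev_induct)
  case (snoc l p)
  have p: "p \<in> R" using snoc.prems transversal(1) unfolding partial_transversal_def by blast
  have pl: "p @ [l] \<in> carrier G" using R_closed snoc.prems by blast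
  then have c: "p \<in> carrier G" "fst l \<in> X" "p @ [l] = p \<otimes> [l]"
    using append_closedD[of p "[l]"] append_eq_mult[of p "[l]"] by auto
  have "gen p l = \<one>"
    using rep_eq[OF p] rep_eq[OF snoc.prems] c R_closed[OF p] by (simp add: gen_def)
  then show ?case
    using crossings_mult[of "[]" p "[l]"] snoc.IH[OF p] c
    by (simp add: one_eq crossing_def)
qed simp

lemma crossings_rep_inv:
  assumes "r \<in> R"
  shows "crossings r (inv r) = []"
proof -
  have "crossings [] (r \<otimes> inv r) = crossings r (inv r)"
    using crossings_mult[of "[]" r "inv r"] crossings_rep[OF assms] R_closed[OF assms]
    by (simp add: one_eq)
  then show ?thesis using R_closed[OF assms] by (simp add: one_eq)
qed

text \<open>Of the three pieces of a Schreier generator the two tree paths are rewritten to the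
  empty word, which leaves the crossing of the edge.\<close>

lemma crossings_gen:
  assumes "g \<in> carrier G" "fst l \<in> X"
  shows "crossings [] (gen g l) = crossing g l"
proof -
  let ?r = "rep g" and ?r' = "rep (g \<otimes> [l])"
  have r: "?r \<in> R" "?r' \<in> R" "?r \<in> carrier G" "?r' \<in> carrier G" using rep assms by auto
  have "H #> (?r \<otimes> [l]) = H #> ?r'"
    using assms coset_cong[of ?r g "[l]"] rep by simp
  then have "crossings (?r \<otimes> [l]) (inv ?r') = crossings ?r' (inv ?r')"
    using r assms by (intro crossings_cong) auto
  then have "crossings (?r \<otimes> [l]) (inv ?r') = []" using crossings_rep_inv r by simp
  moreover have "crossings [] (?r \<otimes> [l]) = foldr push (crossing ?r l) []"
    using crossings_mult[of "[]" ?r "[l]"] crossings_rep[OF r(1)] r assms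
    by (simp add: one_eq)
  moreover have "crossing ?r l = crossing g l"
    using assms rep by (intro crossing_cong) auto
  ultimately show ?thesis
    using crossings_mult[of "[]" "?r \<otimes> [l]" "inv ?r'"] r assms reduced_crossing[of g l]
    by (simp add: gen_def foldr_push_Nil one_eq)
qed

lemma crossings_letter_value:
  assumes "fst l \<in> gens"
  shows "crossings [] (letter_value G l) = [l]" "letter_value G l \<in> H"
proof -
  obtain g x where g: "g \<in> carrier G" "x \<in> X" "fst l = gen g (x, True)" "fst l \<noteq> \<one>"
    using assms by (auto simp: gens_def)
  have c: "crossing g (x, True) = [(fst l, True)]" using g by (simp add: crossing_def)
  have "inv (fst l) = gen (g \<otimes> [(x, True)]) (flip (x, True))" using gen_flip[of g "(x, True)"] g by simp
  then have "crossings [] (inv (fst l)) = rev (map flip (crossing g (x, True)))"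
    using crossings_gen[of "g \<otimes> [(x, True)]" "flip (x, True)"] crossing_flip[of g "(x, True)"] g by simp
  then show "crossings [] (letter_value G l) = [l]"
    using crossings_gen[of g "(x, True)"] g c
    by (cases l) (auto simp: letter_value_def flip_def)
  show "letter_value G l \<in> H"
    using gen_in_H[of g "(x, True)"] g subgroup.m_inv_closed[OF H] by (simp add: letter_value_def)
qed

text \<open>Rewriting from the base point is inverse to \<open>word_value\<close>: on
  \<open>H\<close> by telescoping, and on words over \<open>gens\<close> because each generator is a
  loop, so the next one is rewritten from the base point again and yields its own letter.\<close>

lemma free_basis_gens: "free_basis G gens H"
proof -
  have wH: "word_value G v \<in> H" if "fst ` set v \<subseteq> gens" for v
    using that
    by (induction v) (auto simp: subgroup.one_closed[OF H] subgroup.m_closed[OF H] crossings_letter_value)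
  have "crossings [] (word_value G v) = v" if "v \<in> carrier (free_group gens)" for v
    using that
  proof (induction v)
    case (Cons l v)
    then have l: "fst l \<in> gens" "v \<in> carrier (free_group gens)" "reduced (l # v)"
      using Cons_in_free_group[of l v gens] by (auto simp: free_group_simps)
    then have v: "word_value G v \<in> carrier G" using wH H_closed by (auto simp: free_group_simps)
    have h: "letter_value G l \<in> H" "letter_value G l \<in> carrier G"
      using crossings_letter_value[OF l(1)] H_closed by auto
    have "crossings (letter_value G l) (word_value G v) = crossings [] (word_value G v)"
      using h v coset_eq_H_iff[OF h(2)] by (intro crossings_cong) (auto simp: one_eq)
    then have "crossings [] (word_value G (l # v)) = foldr push [l] v"
      using crossings_mult[of "[]", OF _ h(2) v] crossings_letter_value(1)[OF l(1)] h Cons.IH[OF l(2)]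
      by (simp add: one_eq)
    then show ?case using foldr_push_Nil[OF l(3)] foldr_push_Nil[of v] l(2)
      by (simp add: free_group_simps)
  qed (simp add: one_eq)
  moreover have "word_value G (crossings [] w) = w" if "w \<in> H" for w
    using word_value_crossings[of "[]" w] that H_closed[OF that] rep_H[OF that] rep_H[of \<one>]
      subgroup.one_closed[OF H]
    by (simp add: one_eq)
  ultimately have "bij_betw (word_value G) (carrier (free_group gens)) H"
    using wH crossings_in_gens[of "[]"] H_closed
    by (intro bij_betw_byWitness[where f' = "crossings []"] ballI image_subsetI)
      (simp_all add: free_group_simps(1))
  then show ?thesis using gens_closed by (simp add: free_basis_def)
qed

text \<open>If every edge crossed by a word of \<open>M\<close> has its Schreier generator in
  \<open>M\<close>, then rewriting a word of \<open>M\<close> uses only generators in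
  \<open>M\<close>. These therefore generate \<open>M\<close>, and they inherit freeness from the
  whole basis.\<close>

lemma free_basis_gens_Int:
  assumes M: "subgroup M G" "M \<subseteq> H"
    and gen: "\<And>p l q. p @ l # q \<in> M \<Longrightarrow> gen p l \<in> M"
  shows "free_basis G (gens \<inter> M) M"
proof -
  have "word_value G v \<in> M" if "fst ` set v \<subseteq> gens \<inter> M" for v
    using that
    by (induction v)
      (auto simp: letter_value_def subgroup.one_closed[OF M(1)] subgroup.m_closed[OF M(1)]
        subgroup.m_inv_closed[OF M(1)])
  moreover have "w \<in> word_value G ` carrier (free_group (gens \<inter> M))" if w: "w \<in> M" for w
  proof -
    have wc: "w \<in> carrier G" "w \<in> H" using w M(2) H_closed by auto
    have "crossings [] w \<in> carrier (free_group (gens \<inter> M))"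
    proof (rule crossings_in)
      fix p l q assume wp: "w = p @ l # q"
      then have p: "p \<in> carrier G" "fst l \<in> X"
        using wc append_closedD[of p "l # q"] Cons_closedD[of l q] by auto
      have "fst ` set (crossing p l) \<subseteq> M"
        using gen[of p l q] w wp subgroup.m_inv_closed[OF M(1)] by (auto simp: crossing_def)
      then show "fst ` set (crossing ([] \<otimes> p) l) \<subseteq> gens \<inter> M"
        using crossing_in_gens[OF p] p by (simp add: one_eq)
    qed (use wc in simp_all)
    moreover have "word_value G (crossings [] w) = w"
      using word_value_crossings[of "[]" w] wc rep_H[OF wc(2)] rep_H[of \<one>]
        subgroup.one_closed[OF H]
      by (simp add: one_eq)
    ultimately show ?thesis by (metis image_eqI)
  qed
  ultimately have "word_value G ` carrier (free_group (gens \<inter> M)) = M"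
    by (auto simp: free_group_simps)
  then show ?thesis using free_basis_subset[OF free_basis_gens, of "gens \<inter> M"] by auto
qed

end

section \<open>The subgraph traversed by a symmetric set of words\<close>

locale schreier_part = free_group_subgroup +
  fixes S
  assumes S: "S \<subseteq> H" "\<And>s. s \<in> S \<Longrightarrow> inv s \<in> S"
begin

lemma S_closed: "s \<in> S \<Longrightarrow> s \<in> carrier G"
  using S(1) H_closed by blast

text \<open>Membership of an edge in \<Delta>, in terms of any word \<open>g\<close> leading to its
  origin. Only forward crossings are mentioned; the symmetry of \<open>S\<close> supplies the
  inverse edges.\<close>

definition edge where
  "edge g l \<longleftrightarrow> (\<exists>p q. p @ l # q \<in> S \<and> H #> g = H #> p)"

primrec along where
  "along g [] \<longleftrightarrow> True"
| "along g (l # w) \<longleftrightarrow> edge g l \<and> along (g \<otimes> [l]) w"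

text \<open>The words read along closed paths at the base point inside the part traversed by \<open>S\<close>.\<close>

definition part_subgroup where
  "part_subgroup = {w \<in> H. along [] w}"

lemma edge_letter: "edge g l \<Longrightarrow> fst l \<in> X"
  unfolding edge_def using split_closedD(2) S_closed by blast

lemma edge_cong: "H #> g = H #> g' \<Longrightarrow> edge g l = edge g' l"
  by (simp add: edge_def)

lemma along_cong:
  assumes "H #> g = H #> g'" "g \<in> carrier G" "g' \<in> carrier G"
  shows "along g w = along g' w"
  using assms
proof (induction w arbitrary: g g')
  case (Cons l w)
  have "along (g \<otimes> [l]) w = along (g' \<otimes> [l]) w" if "edge g l"
    using Cons.prems edge_letter[OF that] by (intro Cons.IH coset_cong) auto
  then show ?case using edge_cong[OF Cons.prems(1)] by auto
qed simp

text \<open>The inverse of a word in \<open>S\<close> crosses the same edges backwards. Its prefix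
  before the crossing is \<open>inv q\<close>, which reaches the vertex of
  \<open>p \<otimes> [l]\<close> because the whole word lies in \<open>H\<close>.\<close>

lemma edge_flip:
  assumes "edge g l" "g \<in> carrier G"
  shows "edge (g \<otimes> [l]) (flip l)"
proof -
  obtain p q where p: "p @ l # q \<in> S" "H #> g = H #> p" using assms(1) by (auto simp: edge_def)
  let ?s = "p @ l # q"
  have s: "?s \<in> carrier G" "?s \<in> H" using p S S_closed by auto
  note c = split_closedD[OF s(1)]
  have "inv ?s = rev (map flip q) @ flip l # rev (map flip p)" using s by (simp add: inv_eq)
  moreover have "H #> (g \<otimes> [l]) = H #> inv q"
  proof -
    have "H #> (g \<otimes> [l]) = H #> (p \<otimes> [l])"
      using p(2) assms c by (intro coset_cong) auto
    also have "p \<otimes> [l] = ?s \<otimes> inv q" using c by (simp add: m_assoc)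
    also have "H #> (?s \<otimes> inv q) = H #> inv q" using s c by (intro coset_mult_left) auto
    finally show ?thesis .
  qed
  ultimately show ?thesis using S(2)[OF p(1)] c inv_eq[of q] by (auto simp: edge_def)
qed

lemma along_push:
  assumes "g \<in> carrier G" "edge g l" "along (g \<otimes> [l]) w"
  shows "along g (push l w)"
  using assms edge_letter[OF assms(2)] by (cases w) auto

text \<open>Cancellation only removes steps from a path, so the reduced product stays in the
  subgraph.\<close>

lemma along_mult:
  assumes "g \<in> carrier G" "u \<in> carrier G" "along g u" "along (g \<otimes> u) w"
  shows "along g (u \<otimes> w)"
  using assms
proof (induction u arbitrary: g)
  case Nil
  then show ?case by simp
next
  case (Cons l u)
  then have l: "fst l \<in> X" "u \<in> carrier G" "l # u = [l] \<otimes> u"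
    using Cons_closedD Cons_eq_mult by blast+
  have "g \<otimes> [l] \<otimes> u = g \<otimes> (l # u)" using l Cons.prems by (simp add: m_assoc)
  moreover have "along (g \<otimes> [l]) u" using Cons.prems(3) by simp
  ultimately have "along (g \<otimes> [l]) (u \<otimes> w)" using Cons.prems(1,4) l(1,2) by (intro Cons.IH) auto
  then show ?case using Cons.prems along_push[of g l "u \<otimes> w"] by (simp add: mult_eq)
qed

lemma along_append:
  assumes "g \<in> carrier G" "u @ w \<in> carrier G"
  shows "along g (u @ w) \<longleftrightarrow> along g u \<and> along (g \<otimes> u) w"
  using assms
proof (induction u arbitrary: g)
  case Nil
  then show ?case by (simp add: one_eq)
next
  case (Cons l u)
  then have "u @ w \<in> carrier G" "fst l \<in> X" "l # u \<in> carrier G"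
    using Cons_closedD[of l "u @ w"] append_closedD[of "l # u" w] by auto
  moreover from this have "g \<otimes> [l] \<otimes> u = g \<otimes> (l # u)"
    using Cons.prems Cons_eq_mult[of l u] Cons_closedD[of l u] by (simp add: m_assoc)
  ultimately show ?case using Cons.IH[of "g \<otimes> [l]"] Cons.prems by simp
qed

lemma along_inv:
  assumes "g \<in> carrier G" "w \<in> carrier G" "along g w"
  shows "along (g \<otimes> w) (inv w)"
  using assms
proof (induction w arbitrary: g)
  case Nil
  then show ?case by simp
next
  case (Cons l w)
  then have l: "fst l \<in> X" "w \<in> carrier G" "l # w = [l] \<otimes> w"
    using Cons_closedD Cons_eq_mult by blast+
  have "along (g \<otimes> [l]) w" using Cons.prems(3) by simp
  then have "along (g \<otimes> [l] \<otimes> w) (inv w)" using Cons.prems(1) l(1,2) by (intro Cons.IH) auto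
  moreover have "edge (g \<otimes> [l]) (flip l)" using edge_flip Cons.prems by simp
  ultimately have "along (g \<otimes> [l] \<otimes> w) (inv w \<otimes> [flip l])"
    using Cons.prems l by (intro along_mult) (auto simp: m_assoc)
  then show ?case using l Cons.prems by (simp add: inv_mult_group inv_letter m_assoc)
qed

lemma part_subgroup_subset: "part_subgroup \<subseteq> H"
  by (auto simp: part_subgroup_def)

text \<open>Going out along \<open>u\<close> and back along \<open>w\<close> is a loop in the
  subgraph, since both words end at the same vertex. Closure under inverses and products are
  instances of this.\<close>

lemma quotient_in_part_subgroup:
  assumes "u \<in> carrier G" "w \<in> carrier G" "along [] u" "along [] w" "H #> u = H #> w"
  shows "u \<otimes> inv w \<in> part_subgroup"
proof -
  have "along w (inv w)" using along_inv[of "[]" w] assms by (simp add: one_eq)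
  then have "along u (inv w)" using along_cong[OF assms(5)] assms by simp
  then have "along [] (u \<otimes> inv w)"
    using along_mult[of "[]" u "inv w"] assms by (simp add: one_eq)
  then show ?thesis using assms by (simp add: part_subgroup_def coset_eq_iff)
qed

lemma subgroup_part_subgroup: "subgroup part_subgroup G"
proof -
  have M: "w \<in> carrier G" "w \<in> H" "along [] w" "H #> w = H #> \<one>" if "w \<in> part_subgroup" for w
    using that H_closed coset_eq_H_iff by (auto simp: part_subgroup_def)
  have one: "\<one> \<in> part_subgroup"
    using subgroup.one_closed[OF H] by (simp add: part_subgroup_def one_eq)
  have i: "inv w \<in> part_subgroup" if "w \<in> part_subgroup" for w
    using quotient_in_part_subgroup[of \<one> w] M[OF that] M[OF one] by simp
  have "u \<otimes> w \<in> part_subgroup" if "u \<in> part_subgroup" "w \<in> part_subgroup" for u w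
    using quotient_in_part_subgroup[of u "inv w"] M[OF that(1)] M[OF i[OF that(2)]] M[OF that(2)]
    by simp
  with one i show ?thesis using M(1) by (intro subgroupI) auto
qed

lemma along_prefix_S:
  assumes "p @ q \<in> S"
  shows "along p q"
  using assms
proof (induction q arbitrary: p)
  case (Cons l q)
  have "p @ [l] = p \<otimes> [l]" using split_closedD S_closed[OF Cons.prems] by blast
  moreover have "along (p @ [l]) q" using Cons.IH[of "p @ [l]"] Cons.prems by simp
  moreover have "edge p l" using Cons.prems by (auto simp: edge_def)
  ultimately show ?case by simp
qed simp

lemma S_subset_part_subgroup: "S \<subseteq> part_subgroup"
  using along_prefix_S[of "[]"] S by (auto simp: part_subgroup_def)

lemma along_split:
  assumes "p @ l # q \<in> carrier G" "along [] (p @ l # q)"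
  shows "along [] p" "edge p l" "along [] (p @ [l])"
  using assms along_append[of "[]" p "l # q"] along_append[of "[]" "p @ [l]" q] split_closedD(1)[OF assms(1)]
  by (simp_all add: one_eq)

lemma prefix_S: "p @ q \<in> S \<Longrightarrow> along [] p \<and> p \<in> carrier G"
  using along_prefix_S[of "[]" "p @ q"] S_closed[of "p @ q"] along_append[of "[]" p q]
    append_closedD[of p q]
  by simp

text \<open>This is the surjectivity of \<Gamma>(K) \<rightarrow> \<Gamma>(M) in terms of words.
  That the quotient lies in \<open>part_subgroup\<close>, and not just in \<open>H\<close>, says
  that \<open>p\<close> and \<open>p'\<close> reach the same vertex of \<Gamma>(M).\<close>

lemma part_subgroup_covered:
  assumes "p @ l # q \<in> part_subgroup"
  shows "\<exists>p' q'. p' @ l # q' \<in> S \<and> p \<otimes> inv p' \<in> part_subgroup"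
proof -
  have c: "p @ l # q \<in> carrier G" "along [] (p @ l # q)"
    using assms H_closed by (auto simp: part_subgroup_def)
  note p = along_split[OF c] split_closedD[OF c(1)]
  obtain p' q' where "p' @ l # q' \<in> S" "H #> p = H #> p'" using p(2) by (auto simp: edge_def)
  then show ?thesis using quotient_in_part_subgroup[of p p'] p prefix_S[of p'] by blast
qed

text \<open>While a loop is read, the path so far can be replaced by a prefix of a word in
  \<open>S\<close> with the same end; each replacement costs one generator. The set of all quotients
  depends on \<open>S\<close> alone, and \<open>H\<close> only selects a subset of it. The empty
  word is added to \<open>P\<close> to cover the case that \<open>S\<close> is empty.\<close>

lemma part_subgroup_eq_generate:
  defines "P \<equiv> insert [] {p. \<exists>q. p @ q \<in> S}"
  shows "part_subgroup = generate G (part_subgroup \<inter> {p \<otimes> inv q | p q. p \<in> P \<and> q \<in> P})"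
    (is "_ = generate G ?Q")
proof
  have P: "p \<in> carrier G \<and> along [] p" if "p \<in> P" for p
    using that prefix_S by (auto simp: P_def)
  have sub: "?Q \<subseteq> carrier G" using part_subgroup_subset H_closed by blast
  show "generate G ?Q \<subseteq> part_subgroup"
    by (rule generate_subgroup_incl[OF _ subgroup_part_subgroup]) simp
  note N = generate_is_subgroup[OF sub]
  \<comment> \<open>Invariant of the reading: up to an element already generated, \<open>u\<close>
    is a prefix \<open>p\<close> of a word in \<open>S\<close>.\<close>
  have "\<exists>p\<in>P. u \<otimes> inv p \<in> generate G ?Q" if "u \<in> carrier G" "along [] u" for u
    using that
  proof (induction u rule: rev_induct)
    case Nil
    show ?case using subgroup.one_closed[OF N]
      by (intro bexI[of _ "[]"]) (auto simp: P_def one_eq)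
  next
    case (snoc l u)
    note u = split_closedD[OF snoc.prems(1)] along_split[OF snoc.prems]
    obtain p where p: "p \<in> P" "u \<otimes> inv p \<in> generate G ?Q" using snoc.IH u by blast
    obtain p' q' where p': "p' @ l # q' \<in> S" "H #> u = H #> p'" using u by (auto simp: edge_def)
    note c = split_closedD[OF S_closed[OF p'(1)]]
    have P': "p' \<in> P" "p' @ [l] \<in> P" using p'(1) by (auto simp: P_def intro: exI[of _ "l # q'"] exI[of _ q'])
    have "u \<otimes> inv p \<in> H"
      using p(2) generate_subgroup_incl[OF _ subgroup_part_subgroup, of ?Q] part_subgroup_subset by blast
    then have "H #> p = H #> u" using P[OF p(1)] u coset_eq_iff[of u p] by simp
    then have "H #> p = H #> p'" using p'(2) by simp
    \<comment> \<open>The prefix \<open>p\<close> kept so far and the prefix \<open>p'\<close> of a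
      word that crosses the next edge end at the same vertex, so changing from one to the other is a
      generator.\<close>
    then have "p \<otimes> inv p' \<in> ?Q"
      using quotient_in_part_subgroup[of p p'] P[OF p(1)] P[OF P'(1)] p(1) P'(1) by blast
    then have "p \<otimes> inv p' \<in> generate G ?Q" by (rule generate.incl)
    then have "(u \<otimes> inv p) \<otimes> (p \<otimes> inv p') \<in> generate G ?Q"
      using p(2) subgroup.m_closed[OF N] by blast
    moreover have "(u \<otimes> inv p) \<otimes> (p \<otimes> inv p') = (u @ [l]) \<otimes> inv (p' @ [l])"
    proof -
      have cancel: "x \<otimes> (inv x \<otimes> y) = y" "inv x \<otimes> (x \<otimes> y) = y"
        if "x \<in> carrier G" "y \<in> carrier G" for x y
        using that by (simp_all add: m_assoc[symmetric])
      show ?thesis using u c P[OF p(1)] by (simp add: inv_mult_group m_assoc cancel)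
    qed
    ultimately show ?case using P'(2) by auto
  qed
  note * = this
  show "part_subgroup \<subseteq> generate G ?Q"
  proof
    fix w assume w: "w \<in> part_subgroup"
    then have wc: "w \<in> carrier G" "along [] w" "w \<in> H" using H_closed by (auto simp: part_subgroup_def)
    obtain p where p: "p \<in> P" "w \<otimes> inv p \<in> generate G ?Q" using * wc by blast
    have "w \<otimes> inv p \<in> H"
      using p(2) generate_subgroup_incl[OF _ subgroup_part_subgroup, of ?Q] part_subgroup_subset by blast
    \<comment> \<open>At the end of the loop \<open>p\<close> is back at the base point; compared
      with the empty prefix, \<open>p\<close> itself is a generator.\<close>
    then have "H #> p = H #> \<one>"
      using P[OF p(1)] wc coset_eq_iff[of w p] coset_eq_H_iff[of w] by simp
    moreover have one: "\<one> \<in> P" by (simp add: P_def one_eq)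
    ultimately have "p \<otimes> inv \<one> \<in> part_subgroup"
      using quotient_in_part_subgroup[of p \<one>] P[OF p(1)] P[OF one] by blast
    then have "p \<otimes> inv \<one> \<in> ?Q" using p(1) one by blast
    then have "p \<in> generate G ?Q" using P[OF p(1)] generate.incl[of p ?Q] by simp
    then have "(w \<otimes> inv p) \<otimes> p \<in> generate G ?Q" using p(2) subgroup.m_closed[OF N] by blast
    then show "w \<in> generate G ?Q" using wc P[OF p(1)] by (simp add: m_assoc)
  qed
qed

text \<open>The second conjunct retains what matters about the inner tree: a vertex of the subgraph
  is reached by a tree path inside the subgraph. It holds because the inner tree already represents
  that vertex and representatives are unique.\<close>

lemma transversal_exists:
  "\<exists>R. transversal X H R \<and> (\<forall>r\<in>R. \<forall>g\<in>carrier G. along [] g \<and> H #> g = H #> r \<longrightarrow> along [] r)"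
proof -
  define W where "W = {w \<in> carrier G. along [] w}"
  have pre: "p \<in> carrier G \<and> fst l \<in> X" if "p @ [l] \<in> carrier G" for p l
    using split_closedD[of p l "[]"] that by simp
  have "\<exists>R. partial_transversal R \<and> {[]} \<subseteq> R \<and> R \<subseteq> W \<and> (\<forall>w\<in>W. \<exists>r\<in>R. H #> w = H #> r)"
  proof (rule extend_transversal)
    show "p \<in> W" if "p @ [l] \<in> W" for p l
      using that along_split[of p l "[]"] pre[of p l] by (auto simp: W_def)
    show "r @ [l] \<in> W"
      if *: "w @ [l] \<in> W" "r \<in> W" "H #> w = H #> r" "reduced (r @ [l])" for w l r
    proof -
      have rl: "r @ [l] \<in> carrier G" using * pre[of w l] by (simp add: W_def in_carrier)
      have "edge r l" using along_split[of w l "[]"] * edge_cong[OF *(3)] by (auto simp: W_def)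
      then show ?thesis using rl along_append[of "[]" r "[l]"] *(2)
        by (auto simp: W_def one_eq)
    qed
  qed (auto simp: W_def partial_transversal_def)
  then obtain R1 where R1: "partial_transversal R1" "R1 \<subseteq> W" "\<forall>w\<in>W. \<exists>r\<in>R1. H #> w = H #> r"
    by blast
  have "\<exists>R. partial_transversal R \<and> R1 \<subseteq> R \<and> R \<subseteq> carrier G \<and>
      (\<forall>w\<in>carrier G. \<exists>r\<in>R. H #> w = H #> r)"
  proof (rule extend_transversal[OF order_refl])
    show "p \<in> carrier G" if "p @ [l] \<in> carrier G" for p l
      using that pre by blast
    show "r @ [l] \<in> carrier G"
      if "w @ [l] \<in> carrier G" "r \<in> carrier G" "reduced (r @ [l])" for w l r
      using that pre[of w l] by (simp add: in_carrier)
    show "partial_transversal R1" "R1 \<subseteq> carrier G"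
      using R1(1) by (simp_all add: partial_transversal_def)
  qed
  then obtain R where R: "partial_transversal R" "R1 \<subseteq> R" "\<forall>w\<in>carrier G. \<exists>r\<in>R. H #> w = H #> r"
    by blast
  have "transversal X H R"
    using R(1,3) H free_group_subgroup_axioms unfolding G_def
    by (simp add: transversal_def transversal_axioms_def free_group_subgroup_def)
  moreover have "along [] r" if r: "r \<in> R" "g \<in> carrier G" "along [] g" "H #> g = H #> r" for r g
  proof -
    have "g \<in> W" using r by (simp add: W_def)
    then obtain r1 where r1: "r1 \<in> R1" "H #> g = H #> r1" using R1(3) by blast
    then have "r1 = r"
      using R(1,2) r inj_onD[of "\<lambda>r. H #> r" R r1 r] by (auto simp: partial_transversal_def)
    then show ?thesis using r1 R1(2) by (auto simp: W_def)
  qed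
  ultimately show ?thesis by blast
qed

text \<open>For an edge of the subgraph both tree paths of its Schreier generator stay inside the
  subgraph. The generator is thus a loop there, as the criterion for a basis of the smaller subgroup
  demands.\<close>

lemma free_basis_part_subgroup:
  "\<exists>Y. free_basis G Y H \<and> free_basis G (Y \<inter> part_subgroup) part_subgroup"
proof -
  obtain R where "transversal X H R"
    and R: "\<And>r g. r \<in> R \<Longrightarrow> g \<in> carrier G \<Longrightarrow> along [] g \<Longrightarrow> H #> g = H #> r \<Longrightarrow> along [] r"
    using transversal_exists by blast
  then interpret transversal X G H R unfolding G_def by simp
  have "gen p l \<in> part_subgroup" if "p @ l # q \<in> part_subgroup" for p l q
  proof -
    have c: "p @ l # q \<in> carrier G" "along [] (p @ l # q)"
      using that H_closed by (auto simp: part_subgroup_def)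
    note p = along_split[OF c] split_closedD[OF c(1)]
    let ?r = "rep p" and ?r' = "rep (p \<otimes> [l])"
    have pl: "p \<otimes> [l] \<in> carrier G" "along [] (p \<otimes> [l])" using p by auto
    have r: "?r \<in> carrier G" "?r' \<in> carrier G" "along [] ?r" "along [] ?r'"
      using R[of ?r p] R[of ?r' "p \<otimes> [l]"] rep[of p] rep[OF pl(1)] p pl by auto
    have eq: "H #> ?r = H #> p" "H #> (?r \<otimes> [l]) = H #> ?r'"
      using rep[of p] rep[OF pl(1)] p r coset_cong[of ?r p "[l]"] by auto
    have "along [] (?r \<otimes> [l])"
      using along_mult[of "[]" ?r "[l]"] r p edge_cong[OF eq(1)] by (simp add: one_eq)
    then show ?thesis
      unfolding gen_def using quotient_in_part_subgroup[of "?r \<otimes> [l]" ?r'] r p eq by simp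
  qed
  then show ?thesis
    using free_basis_gens free_basis_gens_Int[OF subgroup_part_subgroup part_subgroup_subset] by blast
qed

lemma free_factor_part_subgroup: "free_factor G part_subgroup H"
proof -
  obtain Y where Y: "free_basis G Y H" "free_basis G (Y \<inter> part_subgroup) part_subgroup"
    using free_basis_part_subgroup by blast
  then have "word_value G ` carrier (free_group (Y \<inter> part_subgroup)) = part_subgroup"
    by (simp add: free_basis_def bij_betw_def)
  then show ?thesis using free_factor_if_free_basis[OF Y(1), of "Y \<inter> part_subgroup"] by simp
qed

end


section \<open>Reading words in folded digraphs\<close>

definition reads ::
    "('v, 'e, 'a) labelled_digraph \<Rightarrow> 'v \<Rightarrow> ('a \<times> bool) list \<Rightarrow> 'v \<Rightarrow> bool" where
  "reads \<Gamma> u w x \<longleftrightarrow> (\<exists>p. is_path \<Gamma> u p x \<and> path_label \<Gamma> p = w)"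

definition letter_of :: "('v, 'e, 'a) labelled_digraph \<Rightarrow> 'e \<times> bool \<Rightarrow> 'a \<times> bool" where
  "letter_of \<Gamma> d = (lab \<Gamma> (fst d), snd d)"

lemma origin_flip [simp]: "origin \<Gamma> (flip d) = terminus \<Gamma> d"
  by (simp add: origin_def terminus_def flip_def)

lemma terminus_flip [simp]: "terminus \<Gamma> (flip d) = origin \<Gamma> d"
  by (simp add: origin_def terminus_def flip_def)

lemma letter_of_flip: "letter_of \<Gamma> (flip d) = flip (letter_of \<Gamma> d)"
  by (simp add: letter_of_def flip_def)

lemma reads_Nil [simp]: "reads \<Gamma> u [] x \<longleftrightarrow> u \<in> verts \<Gamma> \<and> u = x"
  by (auto simp: reads_def path_label_def)

lemma reads_Cons:
  "reads \<Gamma> u (l # w) x \<longleftrightarrow>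
    (\<exists>d. fst d \<in> arcs \<Gamma> \<and> origin \<Gamma> d = u \<and> letter_of \<Gamma> d = l \<and> reads \<Gamma> (terminus \<Gamma> d) w x)"
proof
  assume "reads \<Gamma> u (l # w) x"
  then obtain p where p: "is_path \<Gamma> u p x" "path_label \<Gamma> p = l # w" by (auto simp: reads_def)
  then obtain d q where "p = d # q" by (cases p) (auto simp: path_label_def)
  with p show "\<exists>d. fst d \<in> arcs \<Gamma> \<and> origin \<Gamma> d = u \<and> letter_of \<Gamma> d = l \<and> reads \<Gamma> (terminus \<Gamma> d) w x"
    by (intro exI[of _ d]) (auto simp: reads_def path_label_def letter_of_def)
next
  assume "\<exists>d. fst d \<in> arcs \<Gamma> \<and> origin \<Gamma> d = u \<and> letter_of \<Gamma> d = l \<and> reads \<Gamma> (terminus \<Gamma> d) w x"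
  then obtain d p where "fst d \<in> arcs \<Gamma>" "origin \<Gamma> d = u" "letter_of \<Gamma> d = l"
    "is_path \<Gamma> (terminus \<Gamma> d) p x" "path_label \<Gamma> p = w"
    by (auto simp: reads_def)
  then show "reads \<Gamma> u (l # w) x"
    by (auto simp: reads_def path_label_def letter_of_def intro!: exI[of _ "d # p"])
qed

lemma reads_ConsI:
  "fst d \<in> arcs \<Gamma> \<Longrightarrow> reads \<Gamma> (terminus \<Gamma> d) w x \<Longrightarrow> reads \<Gamma> (origin \<Gamma> d) (letter_of \<Gamma> d # w) x"
  unfolding reads_Cons by blast

lemma reads_end_vertex:
  "reads \<Gamma> u w x \<Longrightarrow> x = u \<or> (\<exists>d. fst d \<in> arcs \<Gamma> \<and> x = terminus \<Gamma> d)"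
  by (induction w arbitrary: u) (auto simp: reads_Cons)

lemma reads_subgraph:
  assumes "reads (\<Gamma>\<lparr>arcs := A\<rparr>) u w x" "A \<subseteq> arcs \<Gamma>"
  shows "reads \<Gamma> u w x"
  using assms(1)
proof (induction w arbitrary: u)
  case (Cons l w)
  then show ?case using assms(2)
    by (auto simp: reads_Cons origin_def terminus_def letter_of_def) blast+
qed simp

context
  fixes X :: "'a set" and \<Gamma> :: "('v, 'e, 'a) labelled_digraph"
  assumes \<Gamma>: "X_digraph X \<Gamma>"
begin

lemma arc_ends:
  assumes "fst d \<in> arcs \<Gamma>"
  shows "origin \<Gamma> d \<in> verts \<Gamma>" "terminus \<Gamma> d \<in> verts \<Gamma>" "fst (letter_of \<Gamma> d) \<in> X"
  using assms \<Gamma>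
  by (auto simp: X_digraph_def wf_digraph_def pre_digraph.truncate_def origin_def terminus_def
      letter_of_def)

lemma reads_verts: "reads \<Gamma> u w x \<Longrightarrow> u \<in> verts \<Gamma> \<and> x \<in> verts \<Gamma>"
  by (induction w arbitrary: u) (auto simp: reads_Cons arc_ends)

lemma reads_letters: "reads \<Gamma> u w x \<Longrightarrow> fst ` set w \<subseteq> X"
proof (induction w arbitrary: u)
  case (Cons l w)
  then obtain d where "fst d \<in> arcs \<Gamma>" "letter_of \<Gamma> d = l" "reads \<Gamma> (terminus \<Gamma> d) w x"
    by (auto simp: reads_Cons)
  then show ?case using arc_ends(3)[of d] Cons.IH by auto
qed simp

lemma reads_append:
  "reads \<Gamma> u (w @ w') y \<longleftrightarrow> (\<exists>x. reads \<Gamma> u w x \<and> reads \<Gamma> x w' y)"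
proof (induction w arbitrary: u)
  case Nil
  then show ?case using reads_verts by auto
next
  case (Cons l w)
  then show ?case by (auto simp: reads_Cons)
qed

lemma reads_inv: "reads \<Gamma> u w x \<Longrightarrow> reads \<Gamma> x (rev (map flip w)) u"
proof (induction w arbitrary: u)
  case (Cons l w)
  then obtain d where d: "fst d \<in> arcs \<Gamma>" "origin \<Gamma> d = u" "letter_of \<Gamma> d = l"
    "reads \<Gamma> (terminus \<Gamma> d) w x"
    by (auto simp: reads_Cons)
  then have "reads \<Gamma> (terminus \<Gamma> d) [flip l] u"
    using reads_ConsI[of "flip d" \<Gamma> "[]" u] arc_ends(1)[of d] by (simp add: letter_of_flip)
  then show ?case using Cons.IH d by (auto simp: reads_append)
qed simp

context
  assumes folded: "folded \<Gamma>"
begin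

lemma edge_unique:
  assumes "fst d \<in> arcs \<Gamma>" "fst d' \<in> arcs \<Gamma>" "origin \<Gamma> d = origin \<Gamma> d'"
    "letter_of \<Gamma> d = letter_of \<Gamma> d'"
  shows "d = d'"
  using assms folded by (auto simp: folded_def origin_def letter_of_def prod_eq_iff split: if_splits)

lemma reads_unique: "reads \<Gamma> u w x \<Longrightarrow> reads \<Gamma> u w y \<Longrightarrow> x = y"
proof (induction w arbitrary: u)
  case (Cons l w)
  then show ?case unfolding reads_Cons using edge_unique by metis
qed simp

text \<open>By folding, the only way to read \<open>flip l\<close> directly after \<open>l\<close>
  is to return along the same edge, so removing the pair keeps the end point.\<close>

lemma reads_push:
  assumes "reads \<Gamma> u (l # w) x"
  shows "reads \<Gamma> u (push l w) x"
proof (cases w)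
  case (Cons m v)
  show ?thesis
  proof (cases "m = flip l")
    case True
    obtain d d' where d: "fst d \<in> arcs \<Gamma>" "origin \<Gamma> d = u" "letter_of \<Gamma> d = l"
      "fst d' \<in> arcs \<Gamma>" "origin \<Gamma> d' = terminus \<Gamma> d" "letter_of \<Gamma> d' = flip l"
      "reads \<Gamma> (terminus \<Gamma> d') v x"
      using assms Cons True by (auto simp: reads_Cons)
    then have "d' = flip d" by (intro edge_unique) (auto simp: letter_of_flip)
    then show ?thesis using Cons True d by simp
  qed (use assms Cons in simp)
qed (use assms in simp)

lemma reads_mult:
  assumes "reads \<Gamma> u w x" "reads \<Gamma> x w' y"
  shows "reads \<Gamma> u (foldr push w w') y"
  using assms(1)
proof (induction w arbitrary: u)
  case Nil
  then show ?case using assms by auto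
next
  case (Cons l w)
  then obtain d where "fst d \<in> arcs \<Gamma>" "origin \<Gamma> d = u" "letter_of \<Gamma> d = l"
    "reads \<Gamma> (terminus \<Gamma> d) w x"
    by (auto simp: reads_Cons)
  then have "reads \<Gamma> u (l # foldr push w w') y" using Cons.IH reads_ConsI by metis
  then show ?case using reads_push by simp
qed

text \<open>Reducedness can be tested on labels: folding makes the label of a reduced path reduced,
  and a path that backtracks never has a reduced label.\<close>

lemma in_loop_labels_iff: "w \<in> loop_labels \<Gamma> v \<longleftrightarrow> reduced w \<and> reads \<Gamma> v w v"
  using reduced_path_label[OF folded] reduced_if_reduced_path_label
  by (fastforce simp: loop_labels_def reduced_loops_def reads_def)

end

end

section \<open>Core graphs and the subgroups they represent\<close>

locale represented =
  fixes X :: "'a set" and \<Gamma> :: "('v, 'e, 'a) labelled_digraph" and v L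
  assumes represents: "represents X (\<Gamma>, v) L"
begin

lemma X_digraph: "X_digraph X \<Gamma>" and folded: "folded \<Gamma>" and core: "core_graph \<Gamma> v"
  using represents by (auto simp: represents_def)

lemma base: "v \<in> verts \<Gamma>"
  using core by (simp add: core_graph_def)

lemma in_L_iff: "w \<in> L \<longleftrightarrow> reduced w \<and> reads \<Gamma> v w v"
  using in_loop_labels_iff[OF X_digraph folded] represents by (auto simp: represents_def)

text \<open>The core condition puts every edge on a reduced loop; \<open>b\<close> records the
  direction in which the loop crosses it.\<close>

lemma arc_read:
  assumes "e \<in> arcs \<Gamma>"
  shows "\<exists>b p q. p @ letter_of \<Gamma> (e, b) # q \<in> L \<and> reads \<Gamma> v p (origin \<Gamma> (e, b))"
proof -
  have "e \<in> arcs (Core \<Gamma> v)" using assms core by (simp add: core_graph_def)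
  then obtain r d where r: "r \<in> reduced_loops \<Gamma> v" "d \<in> set r" "e = fst d"
    by (auto simp: Core_def)
  then obtain p q where "r = p @ d # q" by (auto dest: split_list)
  with r have "path_label \<Gamma> p @ letter_of \<Gamma> d # path_label \<Gamma> q \<in> loop_labels \<Gamma> v"
    "is_path \<Gamma> v p (origin \<Gamma> d)"
    by (auto simp: loop_labels_def reduced_loops_def is_path_append[OF X_digraph] path_label_def
        letter_of_def intro!: image_eqI[of _ _ r])
  moreover have "loop_labels \<Gamma> v = L" using represents by (simp add: represents_def)
  moreover have "d = (e, snd d)" using r by simp
  ultimately show ?thesis by (metis reads_def)
qed

lemma read_prefix: "p @ q \<in> L \<Longrightarrow> \<exists>x. reads \<Gamma> v p x \<and> reads \<Gamma> x q v"
  using in_L_iff reads_append[OF X_digraph] by blast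

lemma vertex_read:
  assumes "x \<in> verts \<Gamma>"
  shows "\<exists>p q. p @ q \<in> L \<and> reads \<Gamma> v p x"
proof (cases "x = v")
  case True
  then show ?thesis using in_L_iff[of "[]"] base by (intro exI[of _ "[]"]) auto
next
  case False
  have "x \<in> verts (Core \<Gamma> v)" using assms core by (simp add: core_graph_def)
  then obtain r where r: "r \<in> reduced_loops \<Gamma> v" "x \<in> origin \<Gamma> ` set r \<union> terminus \<Gamma> ` set r"
    using False unfolding in_verts_Core[OF X_digraph base] by blast
  then obtain p q where pq: "r = p @ q" "is_path \<Gamma> v p x"
    using is_path_split[OF X_digraph, of v r v x] by (auto simp: reduced_loops_def)
  have "path_label \<Gamma> r \<in> L" using r represents by (auto simp: represents_def loop_labels_def)
  then have "path_label \<Gamma> p @ path_label \<Gamma> q \<in> L" using pq by (simp add: path_label_def)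
  then show ?thesis using pq by (auto simp: reads_def)
qed

text \<open>Vertices behave like cosets of \<open>L\<close>. If the quotient of \<open>p\<close> by
  \<open>q\<close> is a loop, then reading it and then \<open>q\<close> amounts to reading
  \<open>p\<close>, and in a folded digraph a word has only one end point.\<close>

lemma same_end_iff:
  assumes "reads \<Gamma> v p x" "reads \<Gamma> v q y" "reduced p" "reduced q"
  shows "foldr push p (rev (map flip q)) \<in> L \<longleftrightarrow> x = y"
proof
  assume "x = y"
  then show "foldr push p (rev (map flip q)) \<in> L"
    using assms reads_mult[OF X_digraph folded assms(1)] reads_inv[OF X_digraph assms(2)]
    by (simp add: in_L_iff reduced_foldr_push reduced_rev_map_flip)
next
  assume "foldr push p (rev (map flip q)) \<in> L"
  then have "reads \<Gamma> v (foldr push (foldr push p (rev (map flip q))) q) y"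
    using reads_mult[OF X_digraph folded _ assms(2)] by (simp add: in_L_iff)
  moreover have "foldr push (foldr push p (rev (map flip q))) q = p"
    using foldr_push_inverse[of "[]" q] assms
    by (simp add: foldr_push_assoc foldr_push_Nil)
  ultimately show "x = y" using reads_unique[OF X_digraph folded] assms(1) by simp
qed

text \<open>The finitely many loops that read the generators span a finite folded subgraph, in which
  all of \<open>L\<close> can be read. A loop through an edge \<open>e\<close> can thus be read
  inside it, and by uniqueness of reading in \<Gamma> this forces \<open>e\<close> to belong to
  it.\<close>

lemma finite_digraph:
  assumes S: "finite S" "L = generate (free_group X) S"
  shows "finite_digraph \<Gamma>"
proof -
  have "\<exists>r. is_path \<Gamma> v r v \<and> path_label \<Gamma> r = s" if "s \<in> S" for s
    using that in_L_iff[of s] S(2) by (auto simp: reads_def intro: generate.incl)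
  then obtain r where r: "\<And>s. s \<in> S \<Longrightarrow> is_path \<Gamma> v (r s) v \<and> path_label \<Gamma> (r s) = s" by metis
  define A where "A = (\<Union>s\<in>S. fst ` set (r s))"
  \<comment> \<open>Only edges are discarded here. The vertices are bounded at the end: each is the
    base point or an end of an edge.\<close>
  let ?\<Gamma> = "\<Gamma>\<lparr>arcs := A\<rparr>"
  have path_arcs: "fst ` set p \<subseteq> arcs \<Gamma>" if "is_path \<Gamma> u p x" for u p x
    using that by (induction p arbitrary: u) auto
  then have A: "A \<subseteq> arcs \<Gamma>" using r unfolding A_def by blast
  have path_sub: "is_path ?\<Gamma> u p x" if "is_path \<Gamma> u p x" "fst ` set p \<subseteq> A" for u p x
    using that by (induction p arbitrary: u) (auto simp: origin_def terminus_def)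
  have "lab \<Gamma> ` A \<subseteq> X" using X_digraph A unfolding X_digraph_def by blast
  then have X: "X_digraph X ?\<Gamma>"
    using X_digraph A by (auto simp: X_digraph_def wf_digraph_def pre_digraph.truncate_def)
  have F: "folded ?\<Gamma>" using folded A by (auto simp: folded_def)
  have SA: "reads ?\<Gamma> v s v" if "s \<in> S" for s
  proof -
    have "is_path ?\<Gamma> v (r s) v" using that r by (intro path_sub) (auto simp: A_def)
    moreover have "path_label ?\<Gamma> (r s) = s" using r[OF that] by (simp add: path_label_def)
    ultimately show ?thesis by (auto simp: reads_def)
  qed
  have inv_eq: "inv\<^bsub>free_group X\<^esub> w = rev (map flip w)" if "w \<in> L" for w
  proof (rule group.inv_equality[OF group_free_group])
    have w: "reduced w" "fst ` set w \<subseteq> X"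
      using that in_L_iff reads_letters[OF X_digraph] by blast+
    then show "rev (map flip w) \<otimes>\<^bsub>free_group X\<^esub> w = \<one>\<^bsub>free_group X\<^esub>"
      "w \<in> carrier (free_group X)" "rev (map flip w) \<in> carrier (free_group X)"
      using foldr_push_inverse[of "[]" w]
      by (auto simp: free_group_simps foldr_push_Nil reduced_rev_map_flip)
  qed
  have LA: "reads ?\<Gamma> v w v" if "w \<in> generate (free_group X) S" for w
    using that
  proof (induction rule: generate.induct)
    case one
    then show ?case using base by (simp add: free_group_simps)
  next
    case (inv s)
    then have "s \<in> L" using S(2) by (simp add: generate.incl)
    then show ?case using reads_inv[OF X SA[OF inv]] by (simp add: inv_eq)
  next
    case (eng u w)
    then show ?case using reads_mult[OF X F] by (simp add: free_group_simps)
  qed (rule SA)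
  have "arcs \<Gamma> \<subseteq> A"
  proof
    fix e assume e: "e \<in> arcs \<Gamma>"
    obtain b p q where p: "p @ letter_of \<Gamma> (e, b) # q \<in> L" "reads \<Gamma> v p (origin \<Gamma> (e, b))"
      using arc_read[OF e] by blast
    then have "reads ?\<Gamma> v (p @ letter_of \<Gamma> (e, b) # q) v" using LA S(2) by simp
    then obtain x d where x: "reads ?\<Gamma> v p x" "fst d \<in> A" "origin \<Gamma> d = x"
      "letter_of \<Gamma> d = letter_of \<Gamma> (e, b)"
      by (auto simp: reads_append[OF X] reads_Cons origin_def letter_of_def)
    then have "x = origin \<Gamma> (e, b)"
      using reads_unique[OF X_digraph folded _ p(2)] reads_subgraph[OF _ A] by blast
    then have "d = (e, b)"
      using x A e by (intro edge_unique[OF X_digraph folded]) auto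
    then show "e \<in> A" using x by simp
  qed
  moreover have "finite A" using S(1) by (simp add: A_def)
  ultimately have fin: "finite (arcs \<Gamma>)" by (rule finite_subset)
  have "verts \<Gamma> \<subseteq> insert v (tail \<Gamma> ` arcs \<Gamma> \<union> head \<Gamma> ` arcs \<Gamma>)"
  proof
    fix x assume "x \<in> verts \<Gamma>"
    then obtain p where "reads \<Gamma> v p x" using vertex_read by blast
    then show "x \<in> insert v (tail \<Gamma> ` arcs \<Gamma> \<union> head \<Gamma> ` arcs \<Gamma>)"
      using reads_end_vertex[of \<Gamma> v p x] by (auto simp: terminus_def)
  qed
  then have "finite (verts \<Gamma>)" by (rule finite_subset) (use fin in simp)
  then show ?thesis using fin by (simp add: finite_digraph_def)
qed

end

text \<open>The inclusion of \<open>K\<close> in \<open>M\<close> yields the morphism, which follows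
  the same word in both digraphs. The condition \<open>covered\<close> yields surjectivity.\<close>

lemma surjective_morphism:
  assumes K: "represents X (\<Gamma>, v) K" and M: "represents X (\<Gamma>', v') M" and KM: "K \<subseteq> M"
    and covered: "\<And>p l q. p @ l # q \<in> M \<Longrightarrow>
      \<exists>p' q'. p' @ l # q' \<in> K \<and> foldr push p (rev (map flip p')) \<in> M"
  shows "\<exists>f g. digraph_morphism \<Gamma> \<Gamma>' f g \<and> f ` verts \<Gamma> = verts \<Gamma>' \<and> g ` arcs \<Gamma> = arcs \<Gamma>' \<and> f v = v'"
proof -
  interpret K: represented X \<Gamma> v K using K by unfold_locales
  interpret M: represented X \<Gamma>' v' M using M by unfold_locales
  have redM: "reduced p" if "p @ q \<in> M" for p q
    using that M.in_L_iff by (auto simp: reduced_append)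
  \<comment> \<open>Two words with the same end in \<Gamma> differ by an element of
    \<open>K\<close>, hence of \<open>M\<close>, and so have the same end in \<Gamma>'. A suitable
    word exists for each vertex, as prefixes of words in \<open>K\<close> can be read in both
    digraphs.\<close>
  define f where "f x = (THE y. \<exists>p. reduced p \<and> reads \<Gamma> v p x \<and> reads \<Gamma>' v' p y)" for x
  have f: "f x = y" if "reduced p" "reads \<Gamma> v p x" "reads \<Gamma>' v' p y" for p x y
    unfolding f_def
  proof (rule the_equality)
    fix z assume "\<exists>q. reduced q \<and> reads \<Gamma> v q x \<and> reads \<Gamma>' v' q z"
    then obtain q where q: "reduced q" "reads \<Gamma> v q x" "reads \<Gamma>' v' q z" by blast
    have "foldr push p (rev (map flip q)) \<in> K"
      using K.same_end_iff[OF that(2) q(2) that(1) q(1)] by simp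
    then show "z = y" using M.same_end_iff[OF that(3) q(3) that(1) q(1)] KM by auto
  qed (use that in blast)
  have edge: "\<exists>d'. fst d' \<in> arcs \<Gamma>' \<and> letter_of \<Gamma>' d' = letter_of \<Gamma> d \<and>
      origin \<Gamma>' d' = f (origin \<Gamma> d) \<and> terminus \<Gamma>' d' = f (terminus \<Gamma> d)"
    if "fst d \<in> arcs \<Gamma>" "p @ letter_of \<Gamma> d # q \<in> K" "reads \<Gamma> v p (origin \<Gamma> d)" for d p q
  proof -
    have pq: "p @ letter_of \<Gamma> d # q \<in> M" using that KM by blast
    then obtain y d' where d': "reads \<Gamma>' v' p y" "fst d' \<in> arcs \<Gamma>'" "origin \<Gamma>' d' = y"
      "letter_of \<Gamma>' d' = letter_of \<Gamma> d"
      using M.read_prefix[of p "letter_of \<Gamma> d # q"] by (auto simp: reads_Cons)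
    have o: "f (origin \<Gamma> d) = y" using f[OF redM[OF pq] that(3) d'(1)] .
    have t: "reads \<Gamma> v (p @ [letter_of \<Gamma> d]) (terminus \<Gamma> d)"
      using that(1,3) reads_ConsI[of d \<Gamma> "[]"] arc_ends(2)[OF K.X_digraph]
      by (auto simp: reads_append[OF K.X_digraph])
    have t': "reads \<Gamma>' v' (p @ [letter_of \<Gamma> d]) (terminus \<Gamma>' d')"
      using d' reads_ConsI[of d' \<Gamma>' "[]"] arc_ends(2)[OF M.X_digraph]
      by (auto simp: reads_append[OF M.X_digraph])
    have "reduced (p @ [letter_of \<Gamma> d])" using redM[of "p @ [letter_of \<Gamma> d]" q] pq by simp
    from f[OF this t t'] o d' show ?thesis by (intro exI[of _ d']) simp
  qed
  have "\<exists>e'. e' \<in> arcs \<Gamma>' \<and> lab \<Gamma>' e' = lab \<Gamma> e \<and> tail \<Gamma>' e' = f (tail \<Gamma> e) \<and> head \<Gamma>' e' = f (head \<Gamma> e)"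
    if e: "e \<in> arcs \<Gamma>" for e
  proof -
    obtain b p q where pq: "p @ letter_of \<Gamma> (e, b) # q \<in> K" "reads \<Gamma> v p (origin \<Gamma> (e, b))"
      using K.arc_read[OF e] by blast
    then obtain d' where "fst d' \<in> arcs \<Gamma>'" "letter_of \<Gamma>' d' = letter_of \<Gamma> (e, b)"
      "origin \<Gamma>' d' = f (origin \<Gamma> (e, b))" "terminus \<Gamma>' d' = f (terminus \<Gamma> (e, b))"
      using edge[of "(e, b)" p q] e pq unfolding fst_conv by blast
    then show ?thesis
      by (intro exI[of _ "fst d'"])
        (auto simp: letter_of_def origin_def terminus_def split: if_splits)
  qed
  then obtain g where g: "\<And>e. e \<in> arcs \<Gamma> \<Longrightarrow> g e \<in> arcs \<Gamma>' \<and> lab \<Gamma>' (g e) = lab \<Gamma> e \<and>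
      tail \<Gamma>' (g e) = f (tail \<Gamma> e) \<and> head \<Gamma>' (g e) = f (head \<Gamma> e)"
    by metis
  have fv: "f v = v'" using f[of "[]" v v'] K.base M.base by simp
  have fV: "f x \<in> verts \<Gamma>'" if "x \<in> verts \<Gamma>" for x
  proof -
    obtain p q where p: "p @ q \<in> K" "reads \<Gamma> v p x" using K.vertex_read \<open>x \<in> verts \<Gamma>\<close> by blast
    then obtain y where "reads \<Gamma>' v' p y" using M.read_prefix KM by blast
    then show ?thesis
      using f[OF redM p(2)] p KM reads_verts[OF M.X_digraph] by blast
  qed
  \<comment> \<open>By \<open>covered\<close> the letter \<open>l\<close> is also read after a
    prefix \<open>p'\<close> of a word in \<open>K\<close> that ends at the same vertex of \<Gamma>'
    as \<open>p\<close>; the edge read there in \<Gamma> is the preimage.\<close>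
  have lift: "\<exists>d. fst d \<in> arcs \<Gamma> \<and> f (origin \<Gamma> d) = y \<and> letter_of \<Gamma> d = l"
    if pq: "p @ l # q \<in> M" "reads \<Gamma>' v' p y" for p l q y
  proof -
    obtain p' q' where p': "p' @ l # q' \<in> K" "foldr push p (rev (map flip p')) \<in> M"
      using covered[OF pq(1)] by blast
    have pM: "p' @ l # q' \<in> M" using p' KM by blast
    obtain y' where "reads \<Gamma>' v' p' y'" using M.read_prefix[OF pM] by blast
    moreover have "y = y'"
      using M.same_end_iff[OF pq(2) calculation redM[OF pq(1)] redM[OF pM]] p'(2) by simp
    moreover obtain d where "reads \<Gamma> v p' (origin \<Gamma> d)" "fst d \<in> arcs \<Gamma>" "letter_of \<Gamma> d = l"
      using K.read_prefix[OF p'(1)] by (auto simp: reads_Cons)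
    ultimately show ?thesis using f[OF redM[OF pM]] by blast
  qed
  have "y \<in> f ` verts \<Gamma>" if "y \<in> verts \<Gamma>'" for y
  proof -
    obtain p q where p: "p @ q \<in> M" "reads \<Gamma>' v' p y" using M.vertex_read[OF \<open>y \<in> verts \<Gamma>'\<close>] by blast
    show ?thesis
    proof (cases q)
      case Nil
      then have "y = v'"
        using p M.in_L_iff reads_unique[OF M.X_digraph M.folded] by auto
      then show ?thesis using fv K.base by blast
    next
      case (Cons l q')
      then obtain d where "fst d \<in> arcs \<Gamma>" "f (origin \<Gamma> d) = y" using lift[of p l q' y] p by auto
      then show ?thesis using arc_ends(1)[OF K.X_digraph] by blast
    qed
  qed
  moreover have "e' \<in> g ` arcs \<Gamma>" if e': "e' \<in> arcs \<Gamma>'" for e'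
  proof -
    obtain b p q where "p @ letter_of \<Gamma>' (e', b) # q \<in> M" "reads \<Gamma>' v' p (origin \<Gamma>' (e', b))"
      using M.arc_read[OF e'] by blast
    then obtain d where d: "fst d \<in> arcs \<Gamma>" "f (origin \<Gamma> d) = origin \<Gamma>' (e', b)"
      "letter_of \<Gamma> d = letter_of \<Gamma>' (e', b)"
      using lift by blast
    have "(g (fst d), b) = (e', b)"
      using d e' g[OF d(1)]
      by (intro edge_unique[OF M.X_digraph M.folded])
        (auto simp: letter_of_def origin_def split: if_splits)
    then show ?thesis using d by blast
  qed
  ultimately have "f ` verts \<Gamma> = verts \<Gamma>'" "g ` arcs \<Gamma> = arcs \<Gamma>'" using fV g by blast+
  moreover have "digraph_morphism \<Gamma> \<Gamma>' f g" using fV g by (auto simp: digraph_morphism_def)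
  ultimately show ?thesis using fv by blast
qed

lemma principal_quotient_subgroup_graph:
  assumes K: "subgroup K (free_group X)" "finitely_generated (free_group X) K"
    and M: "subgroup M (free_group X)" and KM: "K \<subseteq> M"
    and covered: "\<And>p l q. p @ l # q \<in> M \<Longrightarrow>
      \<exists>p' q'. p' @ l # q' \<in> K \<and> foldr push p (rev (map flip p')) \<in> M"
  shows "principal_quotient X K (subgroup_graph X M)"
proof -
  obtain \<Gamma> v where \<Gamma>: "subgroup_graph X K = (\<Gamma>, v)" by fastforce
  obtain \<Gamma>' v' where \<Gamma>': "subgroup_graph X M = (\<Gamma>', v')" by fastforce
  have r: "represents X (\<Gamma>, v) K" "represents X (\<Gamma>', v') M"
    using represents_subgroup_graph[OF K(1)] represents_subgroup_graph[OF M] \<Gamma> \<Gamma>' by simp_all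
  obtain f g where fg: "digraph_morphism \<Gamma> \<Gamma>' f g" "f ` verts \<Gamma> = verts \<Gamma>'" "g ` arcs \<Gamma> = arcs \<Gamma>'" "f v = v'"
    using surjective_morphism[OF r KM] covered by blast
  obtain S where "finite S" "K = generate (free_group X) S"
    using K(2) by (auto simp: finitely_generated_def)
  then have "finite_digraph \<Gamma>"
    using represented.finite_digraph[of X \<Gamma> v K S] r(1) by (simp add: represented_def)
  then have "finite_digraph \<Gamma>'"
    using fg(2,3) finite_imageI unfolding finite_digraph_def by metis
  then show ?thesis
    using r(2) fg \<Gamma> \<Gamma>' unfolding principal_quotient_def represents_def by auto
qed


section \<open>Algebraic extensions\<close>

lemma finite_prefixes:
  assumes "finite S"
  shows "finite {p. \<exists>q. p @ q \<in> S}"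
proof (rule finite_subset)
  show "{p. \<exists>q. p @ q \<in> S} \<subseteq> (\<Union>s\<in>S. (\<lambda>n. take n s) ` {..length s})"
  proof
    fix p assume "p \<in> {p. \<exists>q. p @ q \<in> S}"
    then obtain q where q: "p @ q \<in> S" by blast
    have "p = take (length p) (p @ q)" "length p \<le> length (p @ q)" by simp_all
    then show "p \<in> (\<Union>s\<in>S. (\<lambda>n. take n s) ` {..length s})" using q by blast
  qed
qed (use assms in simp)

lemma (in group) finitely_generated_symmetric:
  assumes "finitely_generated G K"
  obtains S where "finite S" "S \<subseteq> carrier G" "\<And>s. s \<in> S \<Longrightarrow> inv s \<in> S" "K = generate G S"
proof -
  obtain T where T: "finite T" "T \<subseteq> carrier G" "K = generate G T"
    using assms by (auto simp: finitely_generated_def)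
  let ?S = "T \<union> m_inv G ` T"
  have c: "?S \<subseteq> carrier G" using T(2) by auto
  have "?S \<subseteq> generate G T" by (auto intro: generate.incl generate.inv)
  then have "generate G ?S = generate G T"
    using generate_subgroup_incl[OF _ generate_is_subgroup[OF T(2)]] mono_generate[of T ?S] by blast
  moreover have "inv s \<in> ?S" if "s \<in> ?S" for s using that T(2) by auto
  ultimately show ?thesis using that[of ?S] T c by simp
qed

text \<open>The Nielsen-Schreier theorem. For empty \<open>S\<close> the subgraph is just the base
  point, and any spanning tree extends it.\<close>

lemma free_basis_exists:
  assumes "subgroup H (free_group X)"
  shows "\<exists>Y. free_basis (free_group X) Y H"
proof -
  interpret schreier_part X "free_group X" H "{}"
    using assms by (intro schreier_part.intro free_group_subgroup.intro schreier_part_axioms.intro) simp_all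
  show ?thesis using free_basis_part_subgroup by blast
qed

text \<open>The order of the quantifiers is the point: \<open>Q\<close> is chosen before
  \<open>H\<close>. This bounds the number of algebraic extensions and makes the subgroups found for
  different \<open>H\<close> comparable.\<close>

lemma free_factor_through_quotient:
  assumes S: "finite S" "S \<subseteq> carrier (free_group X)"
    and inv: "\<And>s. s \<in> S \<Longrightarrow> inv\<^bsub>free_group X\<^esub> s \<in> S"
  shows "\<exists>Q. finite Q \<and> Q \<subseteq> carrier (free_group X) \<and>
    (\<forall>H. subgroup H (free_group X) \<and> generate (free_group X) S \<subseteq> H \<longrightarrow>
      (\<exists>M \<in> generate (free_group X) ` Pow Q.
        free_factor (free_group X) M H \<and> generate (free_group X) S \<subseteq> M \<and>
        principal_quotient X (generate (free_group X) S) (subgroup_graph X M)))"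
proof -
  let ?F = "free_group X"
  interpret F: group ?F by (rule group_free_group)
  define P where "P = insert [] {p. \<exists>q. p @ q \<in> S}"
  define Q where "Q = {p \<otimes>\<^bsub>?F\<^esub> inv\<^bsub>?F\<^esub> q | p q. p \<in> P \<and> q \<in> P}"
  have K: "subgroup (generate ?F S) ?F" "finitely_generated ?F (generate ?F S)"
    using S F.generate_is_subgroup by (auto simp: finitely_generated_def)
  have "p \<in> carrier ?F" if "p @ q \<in> S" for p q
    using subsetD[OF S(2) that] by (simp add: free_group_simps reduced_append image_Un)
  then have P: "finite P" "P \<subseteq> carrier ?F"
    using finite_prefixes[OF S(1)] by (auto simp: P_def)
  have "Q = (\<lambda>(p, q). p \<otimes>\<^bsub>?F\<^esub> inv\<^bsub>?F\<^esub> q) ` (P \<times> P)" by (auto simp: Q_def)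
  then have "finite Q" "Q \<subseteq> carrier ?F" using P by auto
  moreover have "\<exists>M \<in> generate ?F ` Pow Q. free_factor ?F M H \<and> generate ?F S \<subseteq> M \<and>
      principal_quotient X (generate ?F S) (subgroup_graph X M)"
    if H: "subgroup H ?F" "generate ?F S \<subseteq> H" for H
  proof -
    interpret schreier_part X ?F H S
      using H inv
      by (intro schreier_part.intro free_group_subgroup.intro schreier_part_axioms.intro)
        (auto intro: generate.incl)
    have "part_subgroup = generate ?F (part_subgroup \<inter> Q)"
      unfolding Q_def P_def by (rule part_subgroup_eq_generate)
    then have "part_subgroup \<in> generate ?F ` Pow Q" by blast
    moreover have KM: "generate ?F S \<subseteq> part_subgroup"
      by (rule F.generate_subgroup_incl[OF S_subset_part_subgroup subgroup_part_subgroup])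
    moreover have "principal_quotient X (generate ?F S) (subgroup_graph X part_subgroup)"
    proof (rule principal_quotient_subgroup_graph[OF K subgroup_part_subgroup KM])
      fix p l q assume "p @ l # q \<in> part_subgroup"
      then obtain p' q' where p': "p' @ l # q' \<in> S" "p \<otimes>\<^bsub>?F\<^esub> inv\<^bsub>?F\<^esub> p' \<in> part_subgroup"
        using part_subgroup_covered by blast
      then have "inv\<^bsub>?F\<^esub> p' = rev (map flip p')" using prefix_S inv_eq by blast
      then show "\<exists>p' q'. p' @ l # q' \<in> generate ?F S \<and> foldr push p (rev (map flip p')) \<in> part_subgroup"
        using p' generate.incl[of _ S ?F] by (auto simp: free_group_simps)
    qed
    ultimately show ?thesis using free_factor_part_subgroup by blast
  qed
  ultimately show ?thesis by blast
qed

lemma (in group) algebraic_extension_free_factor: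
  assumes "algebraic_extension G K H" "free_factor G M H" "K \<subseteq> M"
  shows "M = H"
proof -
  obtain C where C: "internal_free_product G H M C"
    using assms(2) by (auto simp: free_factor_def)
  then have "C = {\<one>}"
    using assms unfolding algebraic_extension_def free_extension_def by blast
  then show ?thesis using internal_free_product_trivial C by blast
qed

theorem theorem11p2:
  fixes X :: "'a set"
  assumes "finite X"
  shows
    "(\<forall>K H. subgroup K (free_group X) \<and> finitely_generated (free_group X) K \<and>
        algebraic_extension (free_group X) K H \<longrightarrow>
        principal_quotient X K (subgroup_graph X H) \<and> finitely_generated (free_group X) H) \<and>
     (\<forall>K. subgroup K (free_group X) \<and> finitely_generated (free_group X) K \<longrightarrow>
        finite {H. algebraic_extension (free_group X) K H}) \<and>
     (\<forall>K H. extension (free_group X) K H \<and>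
        finitely_generated (free_group X) K \<and> finitely_generated (free_group X) H \<and>
        free_extension (free_group X) K H \<longrightarrow>
        (\<exists>K' C. subgroup K' (free_group X) \<and> subgroup C (free_group X) \<and> K \<subseteq> K' \<and>
           internal_free_product (free_group X) H K' C \<and>
           principal_quotient X K (subgroup_graph X K'))) \<and>
     (\<forall>K H. extension (free_group X) K H \<and>
        finitely_generated (free_group X) K \<and> finitely_generated (free_group X) H \<longrightarrow>
        (\<exists>K'. free_factor (free_group X) K' H \<and> K \<subseteq> K' \<and>
           algebraic_extension (free_group X) K K'))"
proof -
  let ?F = "free_group X"
  interpret F: group ?F by (rule group_free_group)
  have hull: "\<exists>Q. finite Q \<and> Q \<subseteq> carrier ?F \<and>
      (\<forall>H. subgroup H ?F \<and> K \<subseteq> H \<longrightarrow> (\<exists>M \<in> generate ?F ` Pow Q.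
        free_factor ?F M H \<and> K \<subseteq> M \<and> principal_quotient X K (subgroup_graph X M)))"
    if K: "finitely_generated ?F K" for K
    using F.finitely_generated_symmetric[OF K] free_factor_through_quotient by metis
  \<comment> \<open>A free factor of \<open>H\<close> that contains \<open>K\<close> must be
    \<open>H\<close> itself, so \<open>H\<close> takes over the properties of the subgroup
    \<open>M\<close> found in it.\<close>
  have alg: "H \<in> generate ?F ` Pow Q \<and> principal_quotient X K (subgroup_graph X H)"
    if H: "algebraic_extension ?F K H"
      and Q: "\<forall>H. subgroup H ?F \<and> K \<subseteq> H \<longrightarrow> (\<exists>M \<in> generate ?F ` Pow Q.
        free_factor ?F M H \<and> K \<subseteq> M \<and> principal_quotient X K (subgroup_graph X M))"
    for K H Q
  proof -
    have "subgroup H ?F" "K \<subseteq> H"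
      using H by (auto simp: algebraic_extension_def extension_def)
    with Q[rule_format, of H] obtain M where "M \<in> generate ?F ` Pow Q" "free_factor ?F M H" "K \<subseteq> M"
      "principal_quotient X K (subgroup_graph X M)"
      by blast
    then show ?thesis using F.algebraic_extension_free_factor[OF H] by blast
  qed
  have "principal_quotient X K (subgroup_graph X H) \<and> finitely_generated ?F H"
    if K: "finitely_generated ?F K" and H: "algebraic_extension ?F K H" for K H
  proof -
    obtain Q where Q: "finite Q" "Q \<subseteq> carrier ?F"
      "\<forall>H. subgroup H ?F \<and> K \<subseteq> H \<longrightarrow> (\<exists>M \<in> generate ?F ` Pow Q.
        free_factor ?F M H \<and> K \<subseteq> M \<and> principal_quotient X K (subgroup_graph X M))"
      using hull[OF K] by blast
    from alg[OF H Q(3)] obtain S where S: "S \<subseteq> Q" "H = generate ?F S"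
      and pq: "principal_quotient X K (subgroup_graph X H)"
      by blast
    have "finite S" "S \<subseteq> carrier ?F" using S(1) Q(1,2) finite_subset by auto
    then have "finitely_generated ?F H" using S(2) unfolding finitely_generated_def by blast
    with pq show ?thesis ..
  qed
  moreover have "finite {H. algebraic_extension ?F K H}" if K: "finitely_generated ?F K" for K
  proof -
    obtain Q where Q: "finite Q"
      "\<forall>H. subgroup H ?F \<and> K \<subseteq> H \<longrightarrow> (\<exists>M \<in> generate ?F ` Pow Q.
        free_factor ?F M H \<and> K \<subseteq> M \<and> principal_quotient X K (subgroup_graph X M))"
      using hull[OF K] by blast
    have "{H. algebraic_extension ?F K H} \<subseteq> generate ?F ` Pow Q"
      using alg[OF _ Q(2)] by blast
    then show ?thesis by (rule finite_subset) (use Q(1) in simp)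
  qed
  moreover have "\<exists>K' C. subgroup K' ?F \<and> subgroup C ?F \<and> K \<subseteq> K' \<and>
      internal_free_product ?F H K' C \<and> principal_quotient X K (subgroup_graph X K')"
    if KH: "extension ?F K H" and K: "finitely_generated ?F K" for K H
  proof -
    obtain Q where Q: "\<forall>H. subgroup H ?F \<and> K \<subseteq> H \<longrightarrow> (\<exists>M \<in> generate ?F ` Pow Q.
        free_factor ?F M H \<and> K \<subseteq> M \<and> principal_quotient X K (subgroup_graph X M))"
      using hull[OF K] by blast
    have "subgroup H ?F" "K \<subseteq> H" using KH by (simp_all add: extension_def)
    with Q[rule_format, of H] obtain M where M: "free_factor ?F M H" "K \<subseteq> M"
      "principal_quotient X K (subgroup_graph X M)"
      by blast
    then obtain C where C: "internal_free_product ?F H M C" by (auto simp: free_factor_def)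
    then have "subgroup M ?F" "subgroup C ?F" by (simp_all add: internal_free_product_def)
    with M C show ?thesis by blast
  qed
  moreover have "\<exists>K'. free_factor ?F K' H \<and> K \<subseteq> K' \<and> algebraic_extension ?F K K'"
    if KH: "extension ?F K H" and K: "finitely_generated ?F K" for K H
  proof -
    obtain Q where Q: "finite Q"
      "\<forall>H. subgroup H ?F \<and> K \<subseteq> H \<longrightarrow> (\<exists>M \<in> generate ?F ` Pow Q.
        free_factor ?F M H \<and> K \<subseteq> M \<and> principal_quotient X K (subgroup_graph X M))"
      using hull[OF K] by blast
    define \<M> where "\<M> = {M \<in> generate ?F ` Pow Q. free_factor ?F M H \<and> K \<subseteq> M}"
    have "finite \<M>" using Q(1) by (simp add: \<M>_def)
    moreover have "\<M> \<noteq> {}"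
    proof -
      have "subgroup H ?F" "K \<subseteq> H" using KH by (simp_all add: extension_def)
      with Q(2)[rule_format, of H] obtain M where "M \<in> generate ?F ` Pow Q" "free_factor ?F M H" "K \<subseteq> M"
        by blast
      then have "M \<in> \<M>" by (simp add: \<M>_def)
      then show ?thesis by blast
    qed
    ultimately obtain M where M: "M \<in> \<M>" and min: "\<And>N. N \<in> \<M> \<Longrightarrow> N \<subseteq> M \<Longrightarrow> M = N"
      using finite_has_minimal[of \<M>] by blast
    have MH: "free_factor ?F M H" "K \<subseteq> M" using M by (auto simp: \<M>_def)
    have ext: "extension ?F K M"
      using MH KH unfolding free_factor_def internal_free_product_def extension_def by blast
    moreover have "\<not> free_extension ?F K M"
    proof
      assume "free_extension ?F K M"
      then obtain L C where L: "C \<noteq> {\<one>\<^bsub>?F\<^esub>}" "K \<subseteq> L" "internal_free_product ?F M L C"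
        by (auto simp: free_extension_def)
      then have sub: "subgroup L ?F" "subgroup C ?F" by (auto simp: internal_free_product_def)
      \<comment> \<open>The same construction inside \<open>L\<close>: the list of candidates is
        unchanged, and transitivity of free factors makes \<open>N\<close> a candidate for
        \<open>H\<close> below \<open>M\<close>.\<close>
      obtain N where N: "N \<in> generate ?F ` Pow Q" "free_factor ?F N L" "K \<subseteq> N"
        using Q(2)[rule_format, of L] sub(1) L(2) by blast
      have "free_factor ?F L M" using L(3) by (auto simp: free_factor_def)
      then have "free_factor ?F N H"
        using F.free_factor_trans[OF free_basis_exists] N(2) MH(1) by blast
      then have "N \<in> \<M>" using N by (simp add: \<M>_def)
      moreover have NL: "N \<subseteq> L"
        using N(2) F.internal_free_product_subset(1) by (auto simp: free_factor_def)
      moreover note LM = F.internal_free_product_subset[OF L(3)]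
      ultimately have "M = N" using min by blast
      \<comment> \<open>Minimality collapses the chain of \<open>N\<close>, \<open>L\<close> and
        \<open>M\<close>, so \<open>C\<close> lies in \<open>L\<close>, although the two factors
        meet trivially.\<close>
      then have "C \<subseteq> L" using NL LM by blast
      then have "C \<subseteq> {\<one>\<^bsub>?F\<^esub>}" using F.internal_free_product_disjoint[OF L(3)] by blast
      then show False using L(1) subgroup.one_closed[OF sub(2)] by blast
    qed
    ultimately show ?thesis using MH by (auto simp: algebraic_extension_def)
  qed
  ultimately show ?thesis by blast
qed

end
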